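(* Suppose $S$ is a spectrally negative Lévy process, or a compound Poisson process with exponentially distributed (positive) jumps, and let $X_i(t)=x_i+p_it-S(t)$, $i=1,2$, where $p_1>p_2$. If $x_2>x_1$, then with $T=\frac{x_2-x_1}{p_1-p_2}$ it holds that $$\psi_{\mathrm{sim}}(x_1,x_2)=\psi_2(x_2,T)+\psi_1(x_1)\,\overline\psi_2^{(-\gamma_1)}(x_2,T),$$ $$\psi_{\mathrm{or}}(x_1,x_2)=\psi_1(x_1,T)+\psi_2(x_2)\,\overline\psi_1^{(-\gamma_2)}(x_1,T),$$ $$\psi_{\mathrm{and}}(x_1,x_2)=w_1(x_1,T)+\psi_2(x_2)\,\psi_1^{(-\gamma_2)}(x_1,T).$$
   Context: $S(0)=0$, $x_1,x_2\ge0$; it is assumed that $X_i(t)\to\infty$ a.s. as $t\to\infty$ and that $X_1,X_2$ do not have monotone paths. For $x\ge0$, $\tau_i(x)=\inf\{t\ge0:x+p_it-S(t)<0\}$; $\psi_i(x)=P(\tau_i(x)<\infty)$, $\psi_i(x,t)=P(\tau_i(x)\le t)$, and $w_1(x,t)=P(t<\tau_1(x)<\infty)=\psi_1(x)-\psi_1(x,t)$. Let $\kappa_i(\theta)=\log E[e^{\theta(X_i(1)-x_i)}]$ be the cumulant exponent and $\gamma_i>0$ the adjustment coefficient, $\kappa_i(-\gamma_i)=0$; in the two cases considered, $\psi_i(x)=C_ie^{-\gamma_ix}$ with $C_i=1$ if $S$ is spectrally negative, and $C_i=\lambda/(\mu p_i)$, $\gamma_i=\mu-\lambda/p_i$ if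 $S$ is compound Poisson with jump rate $\lambda$ and exponential jumps with parameter $\mu$. For $c$ with $\kappa_i(c)<\infty$, $P^{(c)}$ is the measure with $\frac{dP^{(c)}}{dP}\big|_{\mathcal F_t}=\exp(c(X_i(t)-x_i)-\kappa_i(c)t)$, where $(\mathcal F_t)$ is the filtration generated by $S$ (this density is the same for $i=1,2$). Set $\psi_i^{(c)}(x,t)=P^{(c)}(\tau_i(x)\le t)$ and $\overline\psi_i^{(c)}(x,t)=1-\psi_i^{(c)}(x,t)$. The two-dimensional ruin probabilities are $\psi_{\mathrm{or}}(x_1,x_2)=P(\exists\,t\ge0:X_1(t)<0\text{ or }X_2(t)<0)$, $\psi_{\mathrm{sim}}(x_1,x_2)=P(\exists\,t\ge0:X_1(t)<0\text{ and }X_2(t)<0)$, and $\psi_{\mathrm{and}}(x_1,x_2)=P(\tau_1(x_1)<\infty\text{ and }\tau_2(x_2)<\infty)$. *)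

theory Defs
  imports "HOL-Probability.Probability"
begin

text \<open>
  Processes are functions \<^typ>\<open>real \<Rightarrow> 'a \<Rightarrow> real\<close>; only their values at times \<open>t \<ge> 0\<close> matter.
\<close>

definition cadlag :: "(real \<Rightarrow> real) \<Rightarrow> bool" where
  "cadlag f \<longleftrightarrow>
     (\<forall>t\<ge>0. (f \<longlongrightarrow> f t) (at_right t)) \<and> (\<forall>t>0. \<exists>l. (f \<longlongrightarrow> l) (at_left t))"

definition jump :: "(real \<Rightarrow> real) \<Rightarrow> real \<Rightarrow> real" where
  "jump f t = f t - Lim (at_left t) f"

definition levy_process :: "'a measure \<Rightarrow> (real \<Rightarrow> 'a \<Rightarrow> real) \<Rightarrow> bool" where
  "levy_process M S \<longleftrightarrow>
     prob_space M \<and>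
     (\<forall>t\<ge>0. S t \<in> borel_measurable M) \<and>
     (\<forall>\<omega>\<in>space M. S 0 \<omega> = 0) \<and>
     (\<forall>\<omega>\<in>space M. cadlag (\<lambda>t. S t \<omega>)) \<and>
     (\<forall>(t :: nat \<Rightarrow> real) n. 0 \<le> t 0 \<and> mono t \<longrightarrow>
        prob_space.indep_vars M (\<lambda>_. borel) (\<lambda>i \<omega>. S (t (Suc i)) \<omega> - S (t i) \<omega>) {..<n}) \<and>
     (\<forall>s\<ge>0. \<forall>h\<ge>0. distr M borel (\<lambda>\<omega>. S (s + h) \<omega> - S s \<omega>) = distr M borel (S h))"

text \<open>
  Spectral negativity only says that there are no positive jumps. The usual exclusion of monotone
  paths is imposed separately, on the processes \<open>x + p t - S t\<close>.
\<close>

definition spectrally_negative :: "'a measure \<Rightarrow> (real \<Rightarrow> 'a \<Rightarrow> real) \<Rightarrow> bool" where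
  "spectrally_negative M S \<longleftrightarrow> (AE \<omega> in M. \<forall>t>0. jump (\<lambda>s. S s \<omega>) t \<le> 0)"

definition poisson_process :: "'a measure \<Rightarrow> real \<Rightarrow> (real \<Rightarrow> 'a \<Rightarrow> nat) \<Rightarrow> bool" where
  "poisson_process M lam N \<longleftrightarrow>
     levy_process M (\<lambda>t \<omega>. real (N t \<omega>)) \<and>
     (\<forall>t>0. distr M (count_space UNIV) (N t) = measure_pmf (poisson_pmf (lam * t)))"

definition compound_poisson_exponential ::
    "'a measure \<Rightarrow> real \<Rightarrow> real \<Rightarrow> (real \<Rightarrow> 'a \<Rightarrow> real) \<Rightarrow> bool" where
  "compound_poisson_exponential M lam \<mu> S \<longleftrightarrow>
     (\<exists>N U. poisson_process M lam N \<and>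
        prob_space.indep_vars M (\<lambda>_. borel) U (UNIV :: nat set) \<and>
        (\<forall>k. distributed M lborel (U k) (exponential_density \<mu>)) \<and>
        prob_space.indep_var M
          (PiM {0..} (\<lambda>_. count_space UNIV)) (\<lambda>\<omega>. \<lambda>t\<in>{0..}. N t \<omega>)
          (PiM UNIV (\<lambda>_. borel)) (\<lambda>\<omega> k. U k \<omega>) \<and>
        (AE \<omega> in M. \<forall>t\<ge>0. S t \<omega> = (\<Sum>k<N t \<omega>. U k \<omega>)))"

definition surplus :: "(real \<Rightarrow> 'a \<Rightarrow> real) \<Rightarrow> real \<Rightarrow> real \<Rightarrow> real \<Rightarrow> 'a \<Rightarrow> real" where
  "surplus S p x t \<omega> = x + p * t - S t \<omega>"

definition ruin_time :: "(real \<Rightarrow> 'a \<Rightarrow> real) \<Rightarrow> real \<Rightarrow> real \<Rightarrow> 'a \<Rightarrow> ereal" where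
  "ruin_time S p x \<omega> = Inf (ereal ` {t. 0 \<le> t \<and> surplus S p x t \<omega> < 0})"

text \<open>
  The probability measure is a parameter, so that the same functions serve for the original
  measure and for the exponentially tilted ones.
\<close>

definition ruin_prob :: "'a measure \<Rightarrow> (real \<Rightarrow> 'a \<Rightarrow> real) \<Rightarrow> real \<Rightarrow> real \<Rightarrow> real" where
  "ruin_prob M S p x = measure M {\<omega> \<in> space M. ruin_time S p x \<omega> < \<infinity>}"

definition ruin_prob_by ::
    "'a measure \<Rightarrow> (real \<Rightarrow> 'a \<Rightarrow> real) \<Rightarrow> real \<Rightarrow> real \<Rightarrow> real \<Rightarrow> real" where
  "ruin_prob_by M S p x t = measure M {\<omega> \<in> space M. ruin_time S p x \<omega> \<le> ereal t}"

definition survival_prob_until ::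
    "'a measure \<Rightarrow> (real \<Rightarrow> 'a \<Rightarrow> real) \<Rightarrow> real \<Rightarrow> real \<Rightarrow> real \<Rightarrow> real" where
  "survival_prob_until M S p x t = 1 - ruin_prob_by M S p x t"

definition late_ruin_prob ::
    "'a measure \<Rightarrow> (real \<Rightarrow> 'a \<Rightarrow> real) \<Rightarrow> real \<Rightarrow> real \<Rightarrow> real \<Rightarrow> real" where
  "late_ruin_prob M S p x t =
     measure M {\<omega> \<in> space M. ereal t < ruin_time S p x \<omega> \<and> ruin_time S p x \<omega> < \<infinity>}"

definition ruin_or ::
    "'a measure \<Rightarrow> (real \<Rightarrow> 'a \<Rightarrow> real) \<Rightarrow> real \<Rightarrow> real \<Rightarrow> real \<Rightarrow> real \<Rightarrow> real" where
  "ruin_or M S p1 p2 x1 x2 =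
     measure M {\<omega> \<in> space M. \<exists>t\<ge>0. surplus S p1 x1 t \<omega> < 0 \<or> surplus S p2 x2 t \<omega> < 0}"

definition ruin_sim ::
    "'a measure \<Rightarrow> (real \<Rightarrow> 'a \<Rightarrow> real) \<Rightarrow> real \<Rightarrow> real \<Rightarrow> real \<Rightarrow> real \<Rightarrow> real" where
  "ruin_sim M S p1 p2 x1 x2 =
     measure M {\<omega> \<in> space M. \<exists>t\<ge>0. surplus S p1 x1 t \<omega> < 0 \<and> surplus S p2 x2 t \<omega> < 0}"

definition ruin_and ::
    "'a measure \<Rightarrow> (real \<Rightarrow> 'a \<Rightarrow> real) \<Rightarrow> real \<Rightarrow> real \<Rightarrow> real \<Rightarrow> real \<Rightarrow> real" where
  "ruin_and M S p1 p2 x1 x2 =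
     measure M {\<omega> \<in> space M. ruin_time S p1 x1 \<omega> < \<infinity> \<and> ruin_time S p2 x2 \<omega> < \<infinity>}"

text \<open>
  The exponential moment may be infinite, in which case the integral and the logarithm take
  meaningless default values; so finiteness is a separate predicate, required wherever
  \<open>cumulant\<close> is used.
\<close>

definition cumulant_finite ::
    "'a measure \<Rightarrow> (real \<Rightarrow> 'a \<Rightarrow> real) \<Rightarrow> real \<Rightarrow> real \<Rightarrow> bool" where
  "cumulant_finite M S p \<theta> \<longleftrightarrow> integrable M (\<lambda>\<omega>. exp (\<theta> * surplus S p 0 1 \<omega>))"

definition cumulant :: "'a measure \<Rightarrow> (real \<Rightarrow> 'a \<Rightarrow> real) \<Rightarrow> real \<Rightarrow> real \<Rightarrow> real" where
  "cumulant M S p \<theta> = ln (\<integral>\<omega>. exp (\<theta> * surplus S p 0 1 \<omega>) \<partial>M)"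

definition adjustment_coefficient ::
    "'a measure \<Rightarrow> (real \<Rightarrow> 'a \<Rightarrow> real) \<Rightarrow> real \<Rightarrow> real \<Rightarrow> bool" where
  "adjustment_coefficient M S p \<gamma> \<longleftrightarrow>
     0 < \<gamma> \<and> cumulant_finite M S p (-\<gamma>) \<and> cumulant M S p (-\<gamma>) = 0"

definition generated_upto :: "'a measure \<Rightarrow> (real \<Rightarrow> 'a \<Rightarrow> real) \<Rightarrow> real \<Rightarrow> 'a measure" where
  "generated_upto M S t =
     sigma (space M) {S s -` B \<inter> space M | s B. 0 \<le> s \<and> s \<le> t \<and> B \<in> sets borel}"

definition generated :: "'a measure \<Rightarrow> (real \<Rightarrow> 'a \<Rightarrow> real) \<Rightarrow> 'a measure" where
  "generated M S = sigma (space M) {S s -` B \<inter> space M | s B. 0 \<le> s \<and> B \<in> sets borel}"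

text \<open>
  \<open>Q\<close> is the measure on the sigma-algebra generated by the whole process whose restriction to the
  information up to each time \<open>t\<close> has density \<open>exp (c (p t - S t) - \<kappa> t)\<close>, where \<open>\<kappa>\<close> is the
  cumulant at \<open>c\<close>. Such a \<open>Q\<close> is unique, and independent of \<open>p\<close> since \<open>c p t\<close> cancels.
\<close>

definition tilted_measure ::
    "'a measure \<Rightarrow> (real \<Rightarrow> 'a \<Rightarrow> real) \<Rightarrow> real \<Rightarrow> real \<Rightarrow> 'a measure \<Rightarrow> bool" where
  "tilted_measure M S p c Q \<longleftrightarrow>
     prob_space Q \<and> space Q = space M \<and> sets Q = sets (generated M S) \<and> cumulant_finite M S p c \<and>
     (\<forall>t\<ge>0. restr_to_subalg Q (generated_upto M S t) =
        density (restr_to_subalg M (generated_upto M S t))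
          (\<lambda>\<omega>. ennreal (exp (c * surplus S p 0 t \<omega> - cumulant M S p c * t))))"

end

theory Submission
  imports Defs
begin

text \<open>
  Put $X_i(t) = x_i + p_i t - S(t)$. Since $X_1(t) - X_2(t) = (p_1 - p_2)(t - T)$, the path $X_1$
  lies below $X_2$ before time $T$, above it after $T$, and the two meet at $T$. Every
  two-dimensional ruin event is therefore decided up to $T$ by one path and after $T$ by the other:
  for instance both are negative at some common time iff $X_2$ becomes negative up to $T$ or $X_1$
  becomes negative from $T$ on.

  What remains is to find the probability of an event \<open>A\<close> of the past up to a time $s$, on which
  $X(s) \<ge> 0$, followed by ruin after $s$. Write $\<psi>(x) = C e^{-\<gamma> x}$. By the Markov property this
  probability is $E[C e^{-\<gamma> X(s)}; A]$, and $e^{-\<gamma> (X(s) - x)}$ is the density of the tilted measure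
  \<open>Q\<close> on the past up to $s$; so it equals $\<psi>(x) Q(A)$ (lemma \<open>ruin_after_eq_tilted\<close>). Applied with
  the right events \<open>A\<close>, this gives all three formulas.

  The proof of that lemma does not treat the exponential formula for $\<psi>$ and the Markov property
  separately. The definition of \<open>Q\<close> says precisely that $L_t = e^{-\<gamma> (X(t) - x)}$ is a martingale, and
  optional stopping at the first time after $s$ at which $X$ is negative, carried out on dyadic
  grids, relates \<open>Q\<close> and \<open>M\<close> on the event that ruin happens in $[s, t]$ (\<open>prob_ruined\<close>). The drift
  makes survival up to $t$ a \<open>Q\<close>-null event in the limit $t \<rightarrow> \<infinity>$ (\<open>survival_vanishes_tilted\<close>).
  The value of $X$ at ruin enters only through its law: it is $0$ when $S$ has no positive jumps
  (\<open>crossing_eq_0\<close>), and minus an exponential variable independent of the past when the claims are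
  exponential (\<open>overshoot_error\<close>). The constant $C$ is the reciprocal of the mean of $e^{-\<gamma> X}$ at ruin.

  A ruin time of exactly \<open>T\<close> needs separate care. The infimum defining the ruin time may equal \<open>T\<close>
  although the path is still nonnegative at \<open>T\<close>; then $X(T) = 0$ and the path becomes negative at once
  after \<open>T\<close>. This event does not belong to the past up to \<open>T\<close>. With exponential claims it is a null
  event (\<open>ruin_at_once_after_null\<close>); without positive jumps $C = 1$, and letting $t \<down> T$ in $L_t$
  shows that it contributes the same amount to both sides (\<open>tilt_at_zero_level\<close>).
\<close>

section \<open>First negative value along dyadic grids\<close>

text \<open>
  Points of the dyadic subdivision of $[s, t]$ into $2^n$ equal parts.
\<close>

definition grid :: "real \<Rightarrow> real \<Rightarrow> nat \<Rightarrow> nat \<Rightarrow> real" where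
  "grid s t n k = s + (t - s) * real k / 2 ^ n"

definition first_neg :: "(real \<Rightarrow> real) \<Rightarrow> real \<Rightarrow> real \<Rightarrow> nat \<Rightarrow> nat \<Rightarrow> bool" where
  "first_neg y s t n k \<longleftrightarrow> y (grid s t n k) < 0 \<and> (\<forall>j<k. 0 \<le> y (grid s t n j))"

text \<open>
  The value of \<open>\<phi>\<close> at the level of the path at the first grid point where the path is negative,
  and 0 if there is none. Writing it as a sum over the grid points splits expectations into
  contributions that each depend on the past up to one fixed grid time.
\<close>

definition at_first_neg ::
    "(real \<Rightarrow> real) \<Rightarrow> (real \<Rightarrow> real) \<Rightarrow> real \<Rightarrow> real \<Rightarrow> nat \<Rightarrow> real" where
  "at_first_neg \<phi> y s t n =
     (\<Sum>k\<le>2 ^ n. if first_neg y s t n k then \<phi> (y (grid s t n k)) else 0)"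

definition right_cont :: "(real \<Rightarrow> real) \<Rightarrow> bool" where
  "right_cont y \<longleftrightarrow> (\<forall>u\<ge>0. (y \<longlongrightarrow> y u) (at_right u))"

lemma grid_0 [simp]: "grid s t n 0 = s"
  by (simp add: grid_def)

lemma grid_last [simp]: "grid s t n (2 ^ n) = t"
  by (simp add: grid_def)

lemma grid_mono: "s \<le> t \<Longrightarrow> j \<le> k \<Longrightarrow> grid s t n j \<le> grid s t n k"
  by (simp add: grid_def divide_right_mono mult_left_mono)

lemma grid_ge: "s \<le> t \<Longrightarrow> s \<le> grid s t n k"
  by (simp add: grid_def)

lemma grid_le: "s \<le> t \<Longrightarrow> k \<le> 2 ^ n \<Longrightarrow> grid s t n k \<le> t"
  using grid_mono[of s t k "2 ^ n" n] by simp

lemma grid_Suc: "grid s t n (Suc k) = grid s t n k + (t - s) / 2 ^ n"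
  by (simp add: grid_def field_simps)

lemma grid_dense:
  assumes "s \<le> u" "u < v" "v \<le> t"
  shows "\<forall>\<^sub>F n in sequentially. \<exists>k\<le>2 ^ n. u \<le> grid s t n k \<and> grid s t n k < v"
proof -
  have "(\<lambda>n. (t - s) / 2 ^ n) \<longlonglongrightarrow> 0"
    using tendsto_mult[OF tendsto_const[of "t - s"] LIMSEQ_power_zero[of "1 / 2 :: real"]]
    by (simp add: field_simps power_divide)
  then have "\<forall>\<^sub>F n in sequentially. (t - s) / 2 ^ n < v - u"
    using assms(2) by (intro order_tendstoD) auto
  then show ?thesis
  proof eventually_elim
    case (elim n)
    define d where "d = (t - s) / 2 ^ n"
    have d: "0 < d" using assms by (simp add: d_def)
    define k where "k = nat \<lceil>(u - s) / d\<rceil>"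
    have k: "real k = of_int \<lceil>(u - s) / d\<rceil>"
      using assms d by (simp add: k_def)
    have "(u - s) / d \<le> real k" "real k < (u - s) / d + 1"
      unfolding k by linarith+
    then have b: "u - s \<le> d * real k" "d * real k < u - s + d"
      using d by (simp_all add: field_simps)
    have g: "grid s t n k = s + d * real k"
      by (simp add: grid_def d_def)
    have lt: "grid s t n k < v" using b elim g d_def by linarith
    have "d * real k < d * 2 ^ n"
      using lt g assms by (simp add: d_def)
    then have "real k < real (2 ^ n)" using d by simp
    then have "k \<le> 2 ^ n" by linarith
    then show ?case using lt b g by (intro exI[of _ k]) auto
  qed
qed

lemma right_cont_seq:
  assumes "right_cont y" "0 \<le> u" "\<And>n. u \<le> \<sigma> n" "\<sigma> \<longlonglongrightarrow> u"
  shows "(\<lambda>n. y (\<sigma> n)) \<longlonglongrightarrow> y u"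
proof -
  have "continuous (at u within {u..}) y"
    using assms(1,2) by (simp add: right_cont_def continuous_within at_within_Ici_at_right)
  then show ?thesis
    using assms(3,4) unfolding continuous_within_sequentially by (auto simp: comp_def)
qed

lemma right_cont_neg_near:
  assumes "right_cont y" "0 \<le> u" "y u < 0" "u < v"
  obtains w where "u < w" "w \<le> v" "\<And>r. u \<le> r \<Longrightarrow> r < w \<Longrightarrow> y r < 0"
proof -
  have "\<forall>\<^sub>F r in at_right u. y r < 0"
    using assms by (intro order_tendstoD(2)[of y "y u"]) (auto simp: right_cont_def)
  then obtain b where b: "u < b" "\<And>r. u < r \<Longrightarrow> r < b \<Longrightarrow> y r < 0"
    unfolding eventually_at_right_field by blast
  show ?thesis
  proof (rule that[of "min b v"])
    show "y r < 0" if "u \<le> r" "r < min b v" for r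
      using that b(2)[of r] assms(3) by (cases "r = u") auto
  qed (use b assms in auto)
qed

lemma neg_on_grid:
  assumes "right_cont y" "0 \<le> s" "u \<in> {s..t}" "y u < 0" "u < v"
  shows "\<forall>\<^sub>F n in sequentially. \<exists>k\<le>2 ^ n. u \<le> grid s t n k \<and> grid s t n k < v \<and> y (grid s t n k) < 0"
proof (cases "u = t")
  case True
  then show ?thesis
    using assms by (auto intro!: always_eventually exI[of _ "2 ^ n" for n])
next
  case False
  obtain w where w: "u < w" "w \<le> min v t" "\<And>r. u \<le> r \<Longrightarrow> r < w \<Longrightarrow> y r < 0"
    using right_cont_neg_near[of y u "min v t"] assms False by auto
  have "\<forall>\<^sub>F n in sequentially. \<exists>k\<le>2 ^ n. u \<le> grid s t n k \<and> grid s t n k < w"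
    using grid_dense[of s u w t] w assms by auto
  then show ?thesis
    by (rule eventually_mono) (use w in force)
qed

lemma ex_neg_iff_grid:
  assumes "right_cont y" "0 \<le> s" "s \<le> t"
  shows "(\<exists>u\<in>{s..t}. y u < 0) \<longleftrightarrow> (\<exists>n. \<exists>k\<le>2 ^ n. y (grid s t n k) < 0)"
proof
  assume "\<exists>u\<in>{s..t}. y u < 0"
  then obtain u where u: "u \<in> {s..t}" "y u < 0" by blast
  have "\<exists>n. \<exists>k\<le>2 ^ n. u \<le> grid s t n k \<and> grid s t n k < u + 1 \<and> y (grid s t n k) < 0"
    using eventually_happens'[OF _ neg_on_grid[OF assms(1,2) u, of "u + 1"]] by auto
  then show "\<exists>n. \<exists>k\<le>2 ^ n. y (grid s t n k) < 0" by blast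
next
  assume "\<exists>n. \<exists>k\<le>2 ^ n. y (grid s t n k) < 0"
  then show "\<exists>u\<in>{s..t}. y u < 0"
    using assms grid_ge grid_le by (metis atLeastAtMost_iff)
qed

lemma at_first_neg_eq:
  assumes "first_neg y s t n k" "k \<le> 2 ^ n"
  shows "at_first_neg \<phi> y s t n = \<phi> (y (grid s t n k))"
proof -
  have "first_neg y s t n j \<longleftrightarrow> j = k" for j
    using assms(1) unfolding first_neg_def by (metis linorder_not_le nat_neq_iff)
  then show ?thesis
    using assms(2) by (simp add: at_first_neg_def sum.delta)
qed

lemma at_first_neg_eq_0:
  assumes "\<And>u. u \<in> {s..t} \<Longrightarrow> 0 \<le> y u" "s \<le> t"
  shows "at_first_neg \<phi> y s t n = 0"
proof -
  have "\<not> first_neg y s t n k" if "k \<le> 2 ^ n" for k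
    using assms grid_ge[of s t n k] grid_le[of s t k n] that
    by (auto simp: first_neg_def not_less)
  then show ?thesis by (simp add: at_first_neg_def)
qed

text \<open>
  The first grid time with a negative value decreases to the infimum \<open>\<tau>\<close> of the times with a
  negative value: a negative value persists for a while to the right, so fine grids detect it.
  Right continuity at \<open>\<tau>\<close> then gives convergence of the level.
\<close>

lemma at_first_neg_tendsto:
  assumes y: "right_cont y" and s: "0 \<le> s" and ex: "\<exists>u\<in>{s..t}. y u < 0"
  defines "\<tau> \<equiv> Inf {u \<in> {s..t}. y u < 0}"
  shows "\<And>\<phi>. isCont \<phi> (y \<tau>) \<Longrightarrow> at_first_neg \<phi> y s t \<longlonglongrightarrow> \<phi> (y \<tau>)" and "y \<tau> \<le> 0"
    and "s \<le> \<tau>" "\<tau> \<le> t"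
proof -
  let ?N = "{u \<in> {s..t}. y u < 0}"
  have bdd: "bdd_below ?N" by (auto intro: bdd_belowI[of _ s])
  have ne: "?N \<noteq> {}" using ex by auto
  show s\<tau>: "s \<le> \<tau>" unfolding \<tau>_def by (rule cInf_greatest[OF ne]) auto
  obtain u0 where u0: "u0 \<in> {s..t}" "y u0 < 0" using ex by blast
  then have st: "s \<le> t" by auto
  have "\<tau> \<le> u0" unfolding \<tau>_def using u0 bdd by (auto intro: cInf_lower)
  then show "\<tau> \<le> t" using u0 by auto
  \<comment> \<open>The alternative \<open>k = 2 ^ n\<close> makes the minimum exist also when no grid value is negative.\<close>
  define \<kappa> where "\<kappa> n = (LEAST k. y (grid s t n k) < 0 \<or> k = 2 ^ n)" for n :: nat
  define \<sigma> where "\<sigma> n = (if y (grid s t n (\<kappa> n)) < 0 then grid s t n (\<kappa> n) else t)" for n :: nat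
  have \<kappa>_le: "\<kappa> n \<le> 2 ^ n" for n unfolding \<kappa>_def by (rule Least_le) simp
  have first: "first_neg y s t n (\<kappa> n)" if "k \<le> 2 ^ n" "y (grid s t n k) < 0" for n k
  proof -
    have P: "y (grid s t n (\<kappa> n)) < 0 \<or> \<kappa> n = 2 ^ n"
      unfolding \<kappa>_def by (rule LeastI[of _ "2 ^ n"]) simp
    have "\<kappa> n \<le> k" unfolding \<kappa>_def using that by (intro Least_le) simp
    moreover have "0 \<le> y (grid s t n j)" if "j < \<kappa> n" for j
      using not_less_Least[OF that[unfolded \<kappa>_def]] by auto
    ultimately show ?thesis
      using P that unfolding first_neg_def by auto
  qed
  have ev: "\<forall>\<^sub>F n in sequentially. first_neg y s t n (\<kappa> n) \<and> \<sigma> n < \<tau> + e" if "e > 0" for e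
  proof -
    have "Inf ?N < \<tau> + e" unfolding \<tau>_def[symmetric] using that by simp
    then obtain u where u: "u \<in> ?N" "u < \<tau> + e"
      using cInf_lessD[OF ne] by blast
    have "\<forall>\<^sub>F n in sequentially. \<exists>k\<le>2 ^ n. u \<le> grid s t n k \<and> grid s t n k < \<tau> + e
        \<and> y (grid s t n k) < 0"
      using neg_on_grid[OF y s, of u t "\<tau> + e"] u by auto
    then show ?thesis
    proof eventually_elim
      case (elim n)
      then obtain k where k: "k \<le> 2 ^ n" "grid s t n k < \<tau> + e" "y (grid s t n k) < 0" by blast
      have "\<kappa> n \<le> k" unfolding \<kappa>_def using k by (intro Least_le) simp
      then have "grid s t n (\<kappa> n) \<le> grid s t n k" using grid_mono st by blast
      moreover have f: "first_neg y s t n (\<kappa> n)" by (rule first[OF k(1,3)])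
      ultimately show ?case using k(2) by (auto simp: \<sigma>_def first_neg_def)
    qed
  qed
  have \<sigma>_ge: "\<tau> \<le> \<sigma> n" for n
  proof (cases "y (grid s t n (\<kappa> n)) < 0")
    case True
    then have "grid s t n (\<kappa> n) \<in> ?N" using grid_ge[OF st] grid_le[OF st \<kappa>_le] by auto
    then show ?thesis using True bdd unfolding \<tau>_def \<sigma>_def by (auto intro: cInf_lower)
  next
    case False
    then show ?thesis using \<open>\<tau> \<le> t\<close> by (simp add: \<sigma>_def)
  qed
  have "\<sigma> \<longlonglongrightarrow> \<tau>"
  proof (rule order_tendstoI)
    show "\<forall>\<^sub>F n in sequentially. a < \<sigma> n" if "a < \<tau>" for a
      using that \<sigma>_ge by (intro always_eventually allI) (meson less_le_trans)
    show "\<forall>\<^sub>F n in sequentially. \<sigma> n < a" if "\<tau> < a" for a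
      using ev[of "a - \<tau>"] that by (auto elim: eventually_mono)
  qed
  then have lim: "(\<lambda>n. y (\<sigma> n)) \<longlonglongrightarrow> y \<tau>"
    using right_cont_seq[OF y _ \<sigma>_ge] s\<tau> s by auto
  have ev1: "\<forall>\<^sub>F n in sequentially. first_neg y s t n (\<kappa> n) \<and> \<sigma> n = grid s t n (\<kappa> n)"
    using ev[of 1] by (auto elim!: eventually_mono simp: \<sigma>_def first_neg_def)
  show "y \<tau> \<le> 0"
    by (rule tendsto_upperbound[OF lim])
      (use ev1 in \<open>auto elim!: eventually_mono simp: first_neg_def\<close>)
  show "at_first_neg \<phi> y s t \<longlonglongrightarrow> \<phi> (y \<tau>)" if "isCont \<phi> (y \<tau>)" for \<phi>
  proof -
    have "(\<lambda>n. \<phi> (y (\<sigma> n))) \<longlonglongrightarrow> \<phi> (y \<tau>)"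
      using isCont_tendsto_compose[OF that lim] .
    moreover have "\<forall>\<^sub>F n in sequentially. \<phi> (y (\<sigma> n)) = at_first_neg \<phi> y s t n"
      using ev1 by eventually_elim (simp add: at_first_neg_eq[OF _ \<kappa>_le])
    ultimately show ?thesis by (rule Lim_transform_eventually)
  qed
qed

lemma at_first_neg_cases:
  obtains "at_first_neg \<phi> y s t n = 0"
  | z where "z < 0" "at_first_neg \<phi> y s t n = \<phi> z"
proof (cases "\<exists>k\<le>2 ^ n. first_neg y s t n k")
  case True
  then obtain k where "k \<le> 2 ^ n" "first_neg y s t n k" by blast
  then show ?thesis
    using at_first_neg_eq[of y s t n k \<phi>] that(2)[of "y (grid s t n k)"] by (auto simp: first_neg_def)
next
  case False
  then have "at_first_neg \<phi> y s t n = 0"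
    unfolding at_first_neg_def by (intro sum.neutral) auto
  then show ?thesis by (rule that(1))
qed

lemma at_first_neg_diff:
  "at_first_neg (\<lambda>z. \<phi> z - c) y s t n = at_first_neg \<phi> y s t n - c * at_first_neg (\<lambda>_. 1) y s t n"
  by (auto simp: at_first_neg_def sum_distrib_left sum_subtractf[symmetric] intro!: sum.cong)

text \<open>
  A form suited to a step-by-step analysis: on each step the condition concerns only the path up to
  the left end point, and the level is taken at the right end point.
\<close>

lemma at_first_neg_shift:
  assumes "0 \<le> y s"
  shows "at_first_neg \<phi> y s t n = (\<Sum>i<2 ^ n. if \<forall>j\<le>i. 0 \<le> y (grid s t n j)
    then (if y (grid s t n (Suc i)) < 0 then \<phi> (y (grid s t n (Suc i))) else 0) else 0)"
proof -
  have "{..2 ^ n :: nat} = insert 0 (Suc ` {..<2 ^ n})"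
    using lessThan_Suc_eq_insert_0[of "2 ^ n"] by (simp add: lessThan_Suc_atMost)
  then have "at_first_neg \<phi> y s t n =
      (\<Sum>k\<in>Suc ` {..<2 ^ n}. if first_neg y s t n k then \<phi> (y (grid s t n k)) else 0)"
    using assms by (simp add: at_first_neg_def first_neg_def)
  also have "\<dots> = (\<Sum>i<2 ^ n. if first_neg y s t n (Suc i) then \<phi> (y (grid s t n (Suc i))) else 0)"
    by (simp add: sum.reindex)
  finally show ?thesis
    by (auto simp: first_neg_def less_Suc_eq_le intro!: sum.cong)
qed

section \<open>The tilted measure on the past up to a fixed time\<close>

lemma right_cont_surplus:
  assumes "cadlag (\<lambda>t. S t \<omega>)"
  shows "right_cont (\<lambda>u. surplus S p x u \<omega>)"
  using assms unfolding right_cont_def surplus_def cadlag_def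
  by (auto intro!: tendsto_intros)

lemma space_generated_upto [simp]: "space (generated_upto M S t) = space M"
  unfolding generated_upto_def by (rule space_measure_of) auto

lemma sets_generated_upto:
  "sets (generated_upto M S t) =
     sigma_sets (space M) {S s -` B \<inter> space M | s B. 0 \<le> s \<and> s \<le> t \<and> B \<in> sets borel}"
  unfolding generated_upto_def by (rule sets_measure_of) auto

lemma sets_generated:
  "sets (generated M S) =
     sigma_sets (space M) {S s -` B \<inter> space M | s B. 0 \<le> s \<and> B \<in> sets borel}"
  unfolding generated_def by (rule sets_measure_of) auto

lemma measurable_generated_upto:
  assumes "0 \<le> u" "u \<le> t"
  shows "S u \<in> borel_measurable (generated_upto M S t)"
  using assms by (intro measurableI) (auto simp: sets_generated_upto intro!: sigma_sets.Basic)

lemma generated_upto_mono: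
  assumes "s \<le> t"
  shows "sets (generated_upto M S s) \<subseteq> sets (generated_upto M S t)"
proof -
  have "{S u -` B \<inter> space M | u B. 0 \<le> u \<and> u \<le> s \<and> B \<in> sets borel}
      \<subseteq> {S u -` B \<inter> space M | u B. 0 \<le> u \<and> u \<le> t \<and> B \<in> sets borel}"
    by (smt (verit, best) Collect_mono assms)
  then show ?thesis unfolding sets_generated_upto by (rule sigma_sets_mono')
qed

lemma generated_upto_subset_generated:
  "sets (generated_upto M S t) \<subseteq> sets (generated M S)"
  unfolding sets_generated_upto sets_generated by (rule sigma_sets_mono') blast

lemma generated_upto_subalgebra:
  assumes "\<And>u. 0 \<le> u \<Longrightarrow> S u \<in> borel_measurable M"
  shows "subalgebra M (generated_upto M S t)"
proof (unfold subalgebra_def, safe)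
  show "x \<in> sets M" if "x \<in> sets (generated_upto M S t)" for x
  proof -
    let ?G = "{S s -` B \<inter> space M | s B. 0 \<le> s \<and> s \<le> t \<and> B \<in> sets borel}"
    have "?G \<subseteq> sets M" using assms by (auto intro: measurable_sets)
    then have "sigma_sets (space M) ?G \<subseteq> sets M" by (rule sets.sigma_sets_subset)
    then show ?thesis using that by (auto simp: sets_generated_upto)
  qed
qed simp_all

text \<open>
  The setting of a single company. The two companies are two instances over the same \<open>M\<close> and \<open>S\<close>, each
  with its own tilted measure.
\<close>

locale tilted_surplus =
  fixes M Q :: "'a measure" and S :: "real \<Rightarrow> 'a \<Rightarrow> real" and p x \<gamma> :: real
  assumes prob_M: "prob_space M"
    and S_measurable: "\<And>t. 0 \<le> t \<Longrightarrow> S t \<in> borel_measurable M"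
    and S_cadlag: "\<And>\<omega>. \<omega> \<in> space M \<Longrightarrow> cadlag (\<lambda>t. S t \<omega>)"
    and adjustment: "adjustment_coefficient M S p \<gamma>"
    and tilted: "tilted_measure M S p (- \<gamma>) Q"
begin

sublocale prob_space M by (rule prob_M)
sublocale Q: prob_space Q using tilted by (simp add: tilted_measure_def)

abbreviation X :: "real \<Rightarrow> 'a \<Rightarrow> real" where "X \<equiv> surplus S p x"
abbreviation F :: "real \<Rightarrow> 'a measure" where "F \<equiv> generated_upto M S"

text \<open>
  The density of \<open>Q\<close> on the past up to \<open>t\<close>. The term with the cumulant is absent because the cumulant
  vanishes at $-\<gamma>$.
\<close>

definition L :: "real \<Rightarrow> 'a \<Rightarrow> real" where "L t \<omega> = exp (\<gamma> * (x - X t \<omega>))"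

definition ruined :: "real \<Rightarrow> real \<Rightarrow> 'a set" where
  "ruined s t = {\<omega> \<in> space M. \<exists>u\<in>{s..t}. X u \<omega> < 0}"

definition ruined_after :: "real \<Rightarrow> 'a set" where
  "ruined_after s = {\<omega> \<in> space M. \<exists>u\<ge>s. X u \<omega> < 0}"

lemma \<gamma>_pos: "0 < \<gamma>"
  using adjustment by (simp add: adjustment_coefficient_def)

lemma space_Q [simp]: "space Q = space M"
  using tilted by (simp add: tilted_measure_def)

lemma subalgebra_F: "subalgebra M (F t)"
  by (rule generated_upto_subalgebra[OF S_measurable])

lemma F_subset: "A \<in> sets (F t) \<Longrightarrow> A \<in> sets M"
  using subalgebra_F by (auto simp: subalgebra_def)

lemma F_mono: "A \<in> sets (F s) \<Longrightarrow> s \<le> t \<Longrightarrow> A \<in> sets (F t)"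
  using generated_upto_mono by blast

lemma subalgebra_Q_F: "subalgebra Q (F t)"
  using tilted generated_upto_subset_generated[of M S t]
  by (simp add: subalgebra_def tilted_measure_def)

lemma F_subset_Q: "A \<in> sets (F t) \<Longrightarrow> A \<in> sets Q"
  using subalgebra_Q_F by (auto simp: subalgebra_def)

lemma X_F [measurable (raw)]: "0 \<le> u \<Longrightarrow> u \<le> t \<Longrightarrow> X u \<in> borel_measurable (F t)"
  using measurable_generated_upto[of u t S M] unfolding surplus_def by measurable

lemma X_M [measurable (raw)]: "0 \<le> u \<Longrightarrow> X u \<in> borel_measurable M"
  using S_measurable[of u] unfolding surplus_def by measurable

lemma L_F: "0 \<le> u \<Longrightarrow> u \<le> t \<Longrightarrow> L u \<in> borel_measurable (F t)"
  unfolding L_def by measurable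

lemma L_M: "0 \<le> u \<Longrightarrow> L u \<in> borel_measurable M"
  unfolding L_def by measurable

lemma L_pos: "0 < L t \<omega>"
  by (simp add: L_def)

lemma restr_Q:
  assumes "0 \<le> t"
  shows "restr_to_subalg Q (F t) = density (restr_to_subalg M (F t)) (\<lambda>\<omega>. ennreal (L t \<omega>))"
proof -
  have "cumulant M S p (- \<gamma>) = 0"
    using adjustment by (simp add: adjustment_coefficient_def)
  moreover have "- \<gamma> * surplus S p 0 t \<omega> = \<gamma> * (x - X t \<omega>)" for \<omega>
    by (simp add: surplus_def algebra_simps)
  ultimately show ?thesis
    using tilted assms unfolding tilted_measure_def L_def by simp
qed

lemma integral_Q:
  fixes Z :: "'a \<Rightarrow> real"
  assumes t: "0 \<le> t" and Z: "Z \<in> borel_measurable (F t)"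
  shows "(\<integral>\<omega>. Z \<omega> \<partial>Q) = (\<integral>\<omega>. L t \<omega> * Z \<omega> \<partial>M)"
proof -
  have [measurable]: "Z \<in> borel_measurable (restr_to_subalg M (F t))"
      "L t \<in> borel_measurable (restr_to_subalg M (F t))"
    using Z L_F[of t t] t by (auto intro: measurable_in_subalg[OF subalgebra_F])
  have "(\<integral>\<omega>. Z \<omega> \<partial>Q) = (\<integral>\<omega>. Z \<omega> \<partial>restr_to_subalg Q (F t))"
    using integral_subalgebra2[OF subalgebra_Q_F Z] by simp
  also have "\<dots> = (\<integral>\<omega>. L t \<omega> *\<^sub>R Z \<omega> \<partial>restr_to_subalg M (F t))"
    unfolding restr_Q[OF t] by (rule integral_density) (auto intro: less_imp_le L_pos)
  also have "\<dots> = (\<integral>\<omega>. L t \<omega> * Z \<omega> \<partial>M)"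
    using Z L_F[of t t] t by (subst integral_subalgebra2[OF subalgebra_F]) auto
  finally show ?thesis .
qed

lemma measure_Q:
  assumes "0 \<le> t" "E \<in> sets (F t)"
  shows "measure Q E = (\<integral>\<omega>. L t \<omega> * indicator E \<omega> \<partial>M)"
  using integral_Q[of t "indicator E"] assms F_subset_Q[OF assms(2)]
    sets.sets_into_space[OF assms(2)]
  by (simp add: Int_absorb2)

text \<open>
  The martingale property of \<open>L\<close>: both sides are the expectation of \<open>Z\<close> under \<open>Q\<close>, computed with the densities at two times.
\<close>

lemma tilt_change_time:
  fixes Z :: "'a \<Rightarrow> real"
  assumes "0 \<le> u" "u \<le> t" "Z \<in> borel_measurable (F u)"
  shows "(\<integral>\<omega>. L t \<omega> * Z \<omega> \<partial>M) = (\<integral>\<omega>. L u \<omega> * Z \<omega> \<partial>M)"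
proof -
  have "Z \<in> borel_measurable (F t)"
    using assms(3) generated_upto_mono[OF assms(2), of M S]
    unfolding measurable_def by auto
  then show ?thesis
    using integral_Q[of t Z] integral_Q[of u Z] assms by simp
qed

lemma L_integrable:
  assumes "0 \<le> t"
  shows "integrable M (L t)"
proof (rule ccontr)
  assume "\<not> integrable M (L t)"
  moreover have "(\<integral>\<omega>. L t \<omega> * 1 \<partial>M) = 1"
    using integral_Q[of t "\<lambda>_. 1"] assms Q.prob_space by simp
  ultimately show False by (simp add: not_integrable_integral_eq)
qed

lemma right_cont_X: "\<omega> \<in> space M \<Longrightarrow> right_cont (\<lambda>u. X u \<omega>)"
  by (rule right_cont_surplus[OF S_cadlag])

lemma ruined_sets:
  assumes "0 \<le> s" "s \<le> t"
  shows "ruined s t \<in> sets (F t)"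
proof -
  have "ruined s t = (\<Union>n. \<Union>k\<in>{..2 ^ n}. {\<omega> \<in> space (F t). X (grid s t n k) \<omega> < 0})"
    unfolding ruined_def using ex_neg_iff_grid[OF right_cont_X assms] by fastforce
  also have "\<dots> \<in> sets (F t)"
    using assms grid_ge[of s t] grid_le[of s t]
    by (intro sets.countable_UN sets.finite_UN image_subsetI borel_measurable_less)
      (auto intro!: X_F order_trans[of 0 s])
  finally show ?thesis .
qed

lemma ruined_after_eq: "ruined_after s = (\<Union>n. ruined s (s + real n))"
proof -
  have "\<exists>n. u \<le> s + real n" for u
    using real_arch_simple[of "u - s"] by (auto simp: algebra_simps)
  then show ?thesis
    unfolding ruined_after_def ruined_def by fastforce
qed

lemma ruined_after_sets: "0 \<le> s \<Longrightarrow> ruined_after s \<in> sets M"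
  unfolding ruined_after_eq by (auto intro!: F_subset[OF ruined_sets])

end

section \<open>Optional stopping at the ruin time\<close>

context tilted_surplus begin

text \<open>
  The level of the surplus at the infimum of the times in $[s, t]$ with a negative surplus;
  meaningful on \<open>ruined s t\<close> only.
\<close>

definition crossing :: "real \<Rightarrow> real \<Rightarrow> 'a \<Rightarrow> real" where
  "crossing s t \<omega> = X (Inf {u \<in> {s..t}. X u \<omega> < 0}) \<omega>"

text \<open>
  The level at ruin may be far below zero, where $e^{-\<gamma> y}$ is unbounded. The cap makes limits along the grids
  interchange with expectations; it is removed by letting \<open>m\<close> tend to infinity.
\<close>

definition capped :: "nat \<Rightarrow> real \<Rightarrow> real" where
  "capped m y = min (exp (- \<gamma> * y)) (exp (real m))"

abbreviation grid_level :: "(real \<Rightarrow> real) \<Rightarrow> real \<Rightarrow> real \<Rightarrow> nat \<Rightarrow> 'a \<Rightarrow> real" where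
  "grid_level \<phi> s t n \<omega> \<equiv> at_first_neg \<phi> (\<lambda>u. X u \<omega>) s t n"

lemma capped_cont: "isCont (capped m) z"
  unfolding capped_def by (intro continuous_intros)

lemma capped_measurable [measurable]: "capped m \<in> borel_measurable borel"
  unfolding capped_def by measurable

lemma capped_nonneg: "0 \<le> capped m y"
  by (simp add: capped_def)

lemma capped_le: "capped m y \<le> exp (real m)"
  by (simp add: capped_def)

lemma first_neg_sets:
  assumes "0 \<le> s" "s \<le> t"
  shows "{\<omega> \<in> space M. first_neg (\<lambda>u. X u \<omega>) s t n k} \<in> sets (F (grid s t n k))"
proof -
  let ?F = "F (grid s t n k)"
  have m: "X (grid s t n j) \<in> borel_measurable ?F" if "j \<le> k" for j
    using assms grid_ge[of s t n j] grid_mono[of s t j k n] that by (intro X_F) auto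
  have "{\<omega> \<in> space ?F. X (grid s t n k) \<omega> < 0} \<in> sets ?F"
    using m[of k] by (intro borel_measurable_less) auto
  moreover have "{\<omega> \<in> space ?F. \<forall>j\<in>{..<k}. 0 \<le> X (grid s t n j) \<omega>} \<in> sets ?F"
    using m by (intro sets.sets_Collect_finite_All borel_measurable_le) auto
  ultimately have "{\<omega> \<in> space ?F. X (grid s t n k) \<omega> < 0} \<inter>
      {\<omega> \<in> space ?F. \<forall>j\<in>{..<k}. 0 \<le> X (grid s t n j) \<omega>} \<in> sets ?F"
    by (rule sets.Int)
  also have "{\<omega> \<in> space ?F. X (grid s t n k) \<omega> < 0} \<inter>
      {\<omega> \<in> space ?F. \<forall>j\<in>{..<k}. 0 \<le> X (grid s t n j) \<omega>} =
      {\<omega> \<in> space M. first_neg (\<lambda>u. X u \<omega>) s t n k}"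
    by (auto simp: first_neg_def)
  finally show ?thesis .
qed

lemma grid_level_eq_sum:
  assumes "\<omega> \<in> space M"
  shows "grid_level \<phi> s t n \<omega> =
     (\<Sum>k\<le>2 ^ n. indicator {\<omega> \<in> space M. first_neg (\<lambda>u. X u \<omega>) s t n k} \<omega> * \<phi> (X (grid s t n k) \<omega>))"
  unfolding at_first_neg_def by (intro sum.cong) (auto simp: assms indicator_def)

lemma grid_level_measurable:
  assumes "0 \<le> s" "s \<le> t" and [measurable]: "\<phi> \<in> borel_measurable borel"
  shows "grid_level \<phi> s t n \<in> borel_measurable M"
proof -
  have [measurable]: "{\<omega> \<in> space M. first_neg (\<lambda>u. X u \<omega>) s t n k} \<in> sets M" for k
    using F_subset[OF first_neg_sets[OF assms(1,2)]] .
  have [measurable]: "X (grid s t n k) \<in> borel_measurable M" for k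
    using assms(1) grid_ge[OF assms(2)] by (intro X_M) (meson order_trans)
  show ?thesis
    by (subst measurable_cong[OF grid_level_eq_sum]) (assumption, measurable)
qed

lemma grid_level_bounded:
  assumes "\<And>z. z \<le> 0 \<Longrightarrow> \<bar>\<phi> z\<bar> \<le> c"
  shows "\<bar>grid_level \<phi> s t n \<omega>\<bar> \<le> c"
proof -
  have "0 \<le> c" using assms[of 0] by (meson abs_ge_zero order_trans order_refl)
  then show ?thesis
    using assms by (cases rule: at_first_neg_cases[where \<phi> = \<phi> and y = "\<lambda>u. X u \<omega>" and s = s and t = t and n = n]) auto
qed

lemma grid_level_tendsto:
  assumes \<omega>: "\<omega> \<in> space M" and st: "0 \<le> s" "s \<le> t" and \<phi>: "\<And>z. isCont \<phi> z"
  shows "(\<lambda>n. grid_level \<phi> s t n \<omega>) \<longlonglongrightarrow> indicator (ruined s t) \<omega> * \<phi> (crossing s t \<omega>)"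
proof (cases "\<omega> \<in> ruined s t")
  case True
  then show ?thesis
    using at_first_neg_tendsto(1)[OF right_cont_X[OF \<omega>] st(1), of t \<phi>] \<phi>
    by (auto simp: ruined_def crossing_def)
next
  case False
  then have "grid_level \<phi> s t n \<omega> = 0" for n
    using \<omega> st(2) by (intro at_first_neg_eq_0) (auto simp: ruined_def not_less)
  then show ?thesis using False by simp
qed

lemma crossing_nonpos:
  "\<omega> \<in> ruined s t \<Longrightarrow> 0 \<le> s \<Longrightarrow> crossing s t \<omega> \<le> 0"
  using at_first_neg_tendsto(2)[OF right_cont_X] by (simp add: ruined_def crossing_def)

lemma integral_grid_level_tendsto:
  assumes st: "0 \<le> s" "s \<le> t" and A: "A \<in> sets M" and W: "integrable M W"
    and \<phi>: "\<And>z. isCont \<phi> z" "\<And>z. z \<le> 0 \<Longrightarrow> \<bar>\<phi> z\<bar> \<le> c"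
  shows "(\<lambda>n. \<integral>\<omega>. W \<omega> * (indicator A \<omega> * grid_level \<phi> s t n \<omega>) \<partial>M) \<longlonglongrightarrow>
     (\<integral>\<omega>. W \<omega> * (indicator (A \<inter> ruined s t) \<omega> * \<phi> (crossing s t \<omega>)) \<partial>M)"
    and "(\<lambda>\<omega>. indicator (ruined s t) \<omega> * \<phi> (crossing s t \<omega>)) \<in> borel_measurable M"
proof -
  have [measurable]: "\<phi> \<in> borel_measurable borel"
    using \<phi>(1) by (intro borel_measurable_continuous_onI) (simp add: continuous_at_imp_continuous_on)
  note [measurable] = grid_level_measurable[OF st] A borel_measurable_integrable[OF W]
  show lim [measurable]:
    "(\<lambda>\<omega>. indicator (ruined s t) \<omega> * \<phi> (crossing s t \<omega>)) \<in> borel_measurable M"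
    by (rule borel_measurable_LIMSEQ_real[OF grid_level_tendsto[OF _ st \<phi>(1)]]) measurable
  have c: "0 \<le> c" using \<phi>(2)[of 0] by (meson abs_ge_zero order_trans order_refl)
  have "(\<lambda>n. \<integral>\<omega>. W \<omega> * (indicator A \<omega> * grid_level \<phi> s t n \<omega>) \<partial>M) \<longlonglongrightarrow>
     (\<integral>\<omega>. W \<omega> * (indicator A \<omega> * (indicator (ruined s t) \<omega> * \<phi> (crossing s t \<omega>))) \<partial>M)"
  proof (rule integral_dominated_convergence[where w = "\<lambda>\<omega>. c * \<bar>W \<omega>\<bar>"])
    show "integrable M (\<lambda>\<omega>. c * \<bar>W \<omega>\<bar>)" using W by auto
    show "AE \<omega> in M. (\<lambda>n. W \<omega> * (indicator A \<omega> * grid_level \<phi> s t n \<omega>)) \<longlonglongrightarrow>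
        W \<omega> * (indicator A \<omega> * (indicator (ruined s t) \<omega> * \<phi> (crossing s t \<omega>)))"
      by (intro AE_I2 tendsto_mult tendsto_const grid_level_tendsto st \<phi>(1))
    show "AE \<omega> in M. norm (W \<omega> * (indicator A \<omega> * grid_level \<phi> s t n \<omega>)) \<le> c * \<bar>W \<omega>\<bar>" for n
    proof (intro AE_I2)
      fix \<omega>
      have "\<bar>indicator A \<omega> * grid_level \<phi> s t n \<omega>\<bar> \<le> c"
        using grid_level_bounded[where \<phi> = \<phi> and c = c and s = s and t = t and n = n and \<omega> = \<omega>] \<phi>(2) c by (auto simp: indicator_def)
      then show "norm (W \<omega> * (indicator A \<omega> * grid_level \<phi> s t n \<omega>)) \<le> c * \<bar>W \<omega>\<bar>"
        by (metis abs_ge_zero abs_mult mult.commute mult_right_mono real_norm_def)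
    qed
  qed measurable
  then show "(\<lambda>n. \<integral>\<omega>. W \<omega> * (indicator A \<omega> * grid_level \<phi> s t n \<omega>) \<partial>M) \<longlonglongrightarrow>
     (\<integral>\<omega>. W \<omega> * (indicator (A \<inter> ruined s t) \<omega> * \<phi> (crossing s t \<omega>)) \<partial>M)"
    by (simp add: indicator_inter_arith mult.assoc)
qed

text \<open>
  Optional stopping along a grid: on the event that the first negative grid value occurs at the
  $k$-th point, the density at \<open>t\<close> may be replaced by the density at that point, which cancels the
  factor $e^{\<gamma> y}$.
\<close>

lemma tilt_grid_level:
  assumes st: "0 \<le> s" "s \<le> t" and A: "A \<in> sets (F s)"
  shows "(\<integral>\<omega>. L t \<omega> * (indicator A \<omega> * grid_level (\<lambda>y. exp (\<gamma> * y) * capped m y) s t n \<omega>) \<partial>M) =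
     exp (\<gamma> * x) * (\<integral>\<omega>. indicator A \<omega> * grid_level (capped m) s t n \<omega> \<partial>M)"
proof -
  let ?g = "\<lambda>y. exp (\<gamma> * y) * capped m y"
  let ?t = "grid s t n"
  define E where "E k = A \<inter> {\<omega> \<in> space M. first_neg (\<lambda>u. X u \<omega>) s t n k}" for k
  have tk: "0 \<le> ?t k" "s \<le> ?t k" for k
    using st grid_ge[OF st(2), of n k] by auto
  have E: "E k \<in> sets (F (?t k))" for k
    unfolding E_def using F_mono[OF A tk(2)] first_neg_sets[OF st] by auto
  have EM [measurable]: "E k \<in> sets M" for k using F_subset[OF E] .
  note [measurable] = X_M[OF tk(1)] L_M
  have g1: "\<bar>?g y\<bar> \<le> 1" for y
  proof -
    have "?g y \<le> exp (\<gamma> * y) * exp (- \<gamma> * y)"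
      unfolding capped_def by (intro mult_left_mono) auto
    then show ?thesis using capped_nonneg[of m y] by (simp add: exp_minus abs_mult)
  qed
  have split: "indicator A \<omega> * grid_level \<phi> s t n \<omega> =
      (\<Sum>k\<le>2 ^ n. indicator (E k) \<omega> * \<phi> (X (?t k) \<omega>))" if "\<omega> \<in> space M" for \<phi> \<omega>
    unfolding grid_level_eq_sum[OF that] E_def indicator_inter_arith sum_distrib_left
    by (simp add: mult.assoc)
  have step: "(\<integral>\<omega>. L t \<omega> * (indicator (E k) \<omega> * ?g (X (?t k) \<omega>)) \<partial>M) =
      exp (\<gamma> * x) * (\<integral>\<omega>. indicator (E k) \<omega> * capped m (X (?t k) \<omega>) \<partial>M)" if "k \<le> 2 ^ n" for k
  proof -
    have [measurable]: "X (?t k) \<in> borel_measurable (F (?t k))" using tk by (intro X_F) auto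
    have [measurable]: "E k \<in> sets (F (?t k))" by (rule E)
    have "(\<integral>\<omega>. L t \<omega> * (indicator (E k) \<omega> * ?g (X (?t k) \<omega>)) \<partial>M) =
        (\<integral>\<omega>. L (?t k) \<omega> * (indicator (E k) \<omega> * ?g (X (?t k) \<omega>)) \<partial>M)"
      by (rule tilt_change_time[OF tk(1) grid_le[OF st(2) that]]) measurable
    also have "\<dots> = (\<integral>\<omega>. exp (\<gamma> * x) * (indicator (E k) \<omega> * capped m (X (?t k) \<omega>)) \<partial>M)"
      by (intro Bochner_Integration.integral_cong)
        (auto simp: L_def right_diff_distrib exp_diff)
    finally show ?thesis by simp
  qed
  have i1: "integrable M (\<lambda>\<omega>. L t \<omega> * (indicator (E k) \<omega> * ?g (X (?t k) \<omega>)))" for k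
  proof (rule Bochner_Integration.integrable_bound)
    show "integrable M (L t)" using st by (intro L_integrable) auto
    show "AE \<omega> in M. norm (L t \<omega> * (indicator (E k) \<omega> * ?g (X (?t k) \<omega>))) \<le> norm (L t \<omega>)"
      using g1 by (intro AE_I2) (auto simp: abs_mult indicator_def intro: mult_left_le)
    have [measurable]: "L t \<in> borel_measurable M" using st by (intro L_M) auto
    show "(\<lambda>\<omega>. L t \<omega> * (indicator (E k) \<omega> * ?g (X (?t k) \<omega>))) \<in> borel_measurable M"
      by measurable
  qed
  have i2: "integrable M (\<lambda>\<omega>. indicator (E k) \<omega> * capped m (X (?t k) \<omega>))" for k
  proof (rule integrable_const_bound[where B = "exp (real m)"])
    show "AE \<omega> in M. norm (indicator (E k) \<omega> * capped m (X (?t k) \<omega>)) \<le> exp (real m)"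
      using capped_nonneg capped_le by (intro AE_I2) (auto simp: indicator_def)
  qed measurable
  have "(\<integral>\<omega>. L t \<omega> * (indicator A \<omega> * grid_level ?g s t n \<omega>) \<partial>M) =
      (\<integral>\<omega>. (\<Sum>k\<le>2 ^ n. L t \<omega> * (indicator (E k) \<omega> * ?g (X (?t k) \<omega>))) \<partial>M)"
    by (intro Bochner_Integration.integral_cong refl) (simp only: split sum_distrib_left)
  also have "\<dots> = (\<Sum>k\<le>2 ^ n. exp (\<gamma> * x) * (\<integral>\<omega>. indicator (E k) \<omega> * capped m (X (?t k) \<omega>) \<partial>M))"
    using i1 by (subst Bochner_Integration.integral_sum) (auto simp: step)
  also have "\<dots> = exp (\<gamma> * x) * (\<integral>\<omega>. (\<Sum>k\<le>2 ^ n. indicator (E k) \<omega> * capped m (X (?t k) \<omega>)) \<partial>M)"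
    using i2 by (subst Bochner_Integration.integral_sum) (auto simp: sum_distrib_left)
  also have "(\<integral>\<omega>. (\<Sum>k\<le>2 ^ n. indicator (E k) \<omega> * capped m (X (?t k) \<omega>)) \<partial>M) =
      (\<integral>\<omega>. indicator A \<omega> * grid_level (capped m) s t n \<omega> \<partial>M)"
    by (intro Bochner_Integration.integral_cong) (auto simp: split)
  finally show ?thesis .
qed

text \<open>
  The law of the level at ruin enters the argument only in this form: conditionally on ruin in a
  time interval, and on any past event \<open>A\<close>, the mean of the capped $e^{-\<gamma> X}$ at ruin is always $1 / c_m$,
  in the limit of fine grids. Intervals of integer length suffice, as the end point is sent to infinity.
\<close>

definition overshoot_const :: "(nat \<Rightarrow> real) \<Rightarrow> bool" where
  "overshoot_const c \<longleftrightarrow>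
     (\<forall>m s j A. 0 \<le> s \<longrightarrow> 0 < j \<longrightarrow> A \<in> sets (F s) \<longrightarrow> (\<forall>\<omega>\<in>A. 0 \<le> X s \<omega>) \<longrightarrow>
        (\<lambda>n. c m * (\<integral>\<omega>. indicator A \<omega> * grid_level (capped m) s (s + real j) n \<omega> \<partial>M))
          \<longlonglongrightarrow> measure M (A \<inter> ruined s (s + real j)))"

text \<open>
  Letting first the grid become fine and then the cap disappear in the optional stopping identity.
\<close>

lemma prob_ruined:
  assumes c: "overshoot_const c" "c \<longlonglongrightarrow> C"
    and s: "0 \<le> s" and j: "0 < j" "t = s + real j"
    and A: "A \<in> sets (F s)" "\<And>\<omega>. \<omega> \<in> A \<Longrightarrow> 0 \<le> X s \<omega>"
  shows "measure M (A \<inter> ruined s t) = C * exp (- \<gamma> * x) * measure Q (A \<inter> ruined s t)"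
proof -
  let ?g = "\<lambda>m y. exp (\<gamma> * y) * capped m y"
  let ?B = "A \<inter> ruined s t"
  have st: "0 \<le> s" "s < t" and st': "s \<le> t" "0 \<le> t" using s j by auto
  have AM: "A \<in> sets M" by (rule F_subset[OF A(1)])
  have BF: "?B \<in> sets (F t)"
    using F_mono[OF A(1) st'(1)] ruined_sets[OF st(1) st'(1)] by auto
  have g0: "0 \<le> ?g m y" for m y by (simp add: capped_nonneg)
  have g1: "?g m y \<le> 1" for m y
  proof -
    have "?g m y \<le> exp (\<gamma> * y) * exp (- \<gamma> * y)"
      unfolding capped_def by (intro mult_left_mono) auto
    then show ?thesis by (simp add: exp_minus)
  qed
  have gc: "isCont (?g m) z" for m z
    by (intro continuous_intros capped_cont)
  \<comment> \<open>For each level the cap is inactive from some \<open>m\<close> on.\<close>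
  have glim: "(\<lambda>m. ?g m y) \<longlonglongrightarrow> 1" for y
  proof -
    have "\<forall>\<^sub>F m in sequentially. - \<gamma> * y \<le> real m"
      using filterlim_real_sequentially by (simp add: filterlim_at_top)
    then have "\<forall>\<^sub>F m in sequentially. 1 = ?g m y"
      by eventually_elim (simp add: capped_def min_def flip: exp_add)
    then show ?thesis by (rule Lim_transform_eventually[OF tendsto_const])
  qed
  have eq: "measure M ?B =
      c m * exp (- \<gamma> * x) * (\<integral>\<omega>. L t \<omega> * (indicator ?B \<omega> * ?g m (crossing s t \<omega>)) \<partial>M)" for m
  proof -
    have lim: "(\<lambda>n. c m * exp (- \<gamma> * x) *
          (\<integral>\<omega>. L t \<omega> * (indicator A \<omega> * grid_level (?g m) s t n \<omega>) \<partial>M)) \<longlonglongrightarrow>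
        c m * exp (- \<gamma> * x) * (\<integral>\<omega>. L t \<omega> * (indicator ?B \<omega> * ?g m (crossing s t \<omega>)) \<partial>M)"
      using g0 g1 st(1) st' by (intro tendsto_mult tendsto_const
        integral_grid_level_tendsto(1)[where c = 1] AM L_integrable gc) (auto simp: abs_le_iff)
    have grid: "c m * exp (- \<gamma> * x) *
          (\<integral>\<omega>. L t \<omega> * (indicator A \<omega> * grid_level (?g m) s t n \<omega>) \<partial>M) =
        c m * (\<integral>\<omega>. indicator A \<omega> * grid_level (capped m) s t n \<omega> \<partial>M)" for n
      unfolding tilt_grid_level[OF st(1) st'(1) A(1)] by (simp add: exp_minus field_simps)
    have "(\<lambda>n. c m * (\<integral>\<omega>. indicator A \<omega> * grid_level (capped m) s t n \<omega> \<partial>M))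
        \<longlonglongrightarrow> measure M ?B"
      using c(1) s j A unfolding overshoot_const_def by blast
    from LIMSEQ_unique[OF this lim[unfolded grid]] show ?thesis .
  qed
  have "(\<lambda>m. \<integral>\<omega>. L t \<omega> * (indicator ?B \<omega> * ?g m (crossing s t \<omega>)) \<partial>M)
      \<longlonglongrightarrow> (\<integral>\<omega>. L t \<omega> * indicator ?B \<omega> \<partial>M)"
  proof (rule integral_dominated_convergence[where w = "L t"])
    note [measurable] = L_M[OF st'(2)] F_subset[OF BF] AM
    have [measurable]: "(\<lambda>\<omega>. indicator (ruined s t) \<omega> * ?g m (crossing s t \<omega>)) \<in> borel_measurable M" for m
      using g0 g1 st(1) st' by (intro integral_grid_level_tendsto(2)[where c = 1]
        AM L_integrable[OF st'(2)] gc) (auto simp: abs_le_iff)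
    show "(\<lambda>\<omega>. L t \<omega> * indicator ?B \<omega>) \<in> borel_measurable M" by measurable
    show "(\<lambda>\<omega>. L t \<omega> * (indicator ?B \<omega> * ?g m (crossing s t \<omega>))) \<in> borel_measurable M" for m
      unfolding indicator_inter_arith mult.assoc[of "indicator A _"] by measurable
    show "integrable M (L t)" by (rule L_integrable[OF st'(2)])
    show "AE \<omega> in M. (\<lambda>m. L t \<omega> * (indicator ?B \<omega> * ?g m (crossing s t \<omega>)))
        \<longlonglongrightarrow> L t \<omega> * indicator ?B \<omega>"
      using tendsto_mult[OF tendsto_const tendsto_mult[OF tendsto_const glim]] by fastforce
    show "AE \<omega> in M. norm (L t \<omega> * (indicator ?B \<omega> * ?g m (crossing s t \<omega>))) \<le> L t \<omega>" for m
    proof (intro AE_I2)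
      fix \<omega>
      have "\<bar>indicator ?B \<omega> * ?g m (crossing s t \<omega>)\<bar> \<le> 1"
        using g0 g1 by (auto simp: indicator_def abs_of_nonneg simp del: abs_mult)
      then show "norm (L t \<omega> * (indicator ?B \<omega> * ?g m (crossing s t \<omega>))) \<le> L t \<omega>"
        using L_pos[of t \<omega>] by (simp add: abs_mult[of "L t \<omega>"] mult_left_le del: abs_mult)
    qed
  qed
  then have "(\<lambda>m. c m * exp (- \<gamma> * x) * (\<integral>\<omega>. L t \<omega> * (indicator ?B \<omega> * ?g m (crossing s t \<omega>)) \<partial>M))
      \<longlonglongrightarrow> C * exp (- \<gamma> * x) * measure Q ?B"
    unfolding measure_Q[OF st'(2) BF] by (intro tendsto_mult tendsto_const c(2))
  then show ?thesis unfolding eq[symmetric] by (simp add: LIMSEQ_const_iff)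
qed

text \<open>
  On survival the density \<open>L\<close> is bounded by $e^{\<gamma> x}$, and it tends to 0 because the surplus tends to
  infinity under \<open>M\<close>.
\<close>

lemma survival_vanishes_tilted:
  assumes drift: "AE \<omega> in M. filterlim (\<lambda>t. X t \<omega>) at_top at_top"
    and s: "0 \<le> s" and A: "A \<in> sets (F s)"
  shows "(\<lambda>n. measure Q (A - ruined s (s + real n))) \<longlonglongrightarrow> 0"
proof -
  have E: "A - ruined s (s + real n) \<in> sets (F (s + real n))" for n
    using F_mono[OF A] ruined_sets[OF s] by auto
  note [measurable] = F_subset[OF E]
  have [measurable]: "L (s + real n) \<in> borel_measurable M" for n using s by (intro L_M) auto
  have "(\<lambda>n. \<integral>\<omega>. L (s + real n) \<omega> * indicator (A - ruined s (s + real n)) \<omega> \<partial>M)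
      \<longlonglongrightarrow> (\<integral>\<omega>. 0 \<partial>M)"
  proof (rule integral_dominated_convergence[where w = "\<lambda>_. exp (\<gamma> * x)"])
    show "AE \<omega> in M. norm (L (s + real n) \<omega> * indicator (A - ruined s (s + real n)) \<omega>) \<le> exp (\<gamma> * x)" for n
      using \<gamma>_pos sets.sets_into_space[OF A]
      by (intro AE_I2) (auto simp: indicator_def L_def ruined_def not_less)
    show "AE \<omega> in M. (\<lambda>n. L (s + real n) \<omega> * indicator (A - ruined s (s + real n)) \<omega>) \<longlonglongrightarrow> 0"
      using drift
    proof eventually_elim
      case (elim \<omega>)
      have "filterlim (\<lambda>n. s + real n) at_top sequentially"
        by (intro filterlim_tendsto_add_at_top[OF tendsto_const] filterlim_real_sequentially)
      from filterlim_compose[OF elim this]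
      have "filterlim (\<lambda>n. \<gamma> * (- x + X (s + real n) \<omega>)) at_top sequentially"
        by (intro filterlim_tendsto_pos_mult_at_top[OF tendsto_const \<gamma>_pos]
          filterlim_tendsto_add_at_top[OF tendsto_const])
      then have "filterlim (\<lambda>n. - (\<gamma> * (- x + X (s + real n) \<omega>))) at_bot sequentially"
        by (simp only: filterlim_uminus_at_top)
      then have "(\<lambda>n. exp (- (\<gamma> * (- x + X (s + real n) \<omega>)))) \<longlonglongrightarrow> 0"
        by (rule filterlim_compose[OF exp_at_bot])
      then have L0: "(\<lambda>n. L (s + real n) \<omega>) \<longlonglongrightarrow> 0"
        by (simp add: L_def algebra_simps)
      show ?case
        by (rule tendsto_sandwich[OF _ _ tendsto_const L0])
          (auto simp: indicator_def less_imp_le[OF L_pos])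
    qed
  qed auto
  moreover have "measure Q (A - ruined s (s + real n)) =
      (\<integral>\<omega>. L (s + real n) \<omega> * indicator (A - ruined s (s + real n)) \<omega> \<partial>M)" for n
    using s by (intro measure_Q E) auto
  ultimately show ?thesis by simp
qed

lemma prob_ruined_after:
  assumes c: "overshoot_const c" "c \<longlonglongrightarrow> C"
    and drift: "AE \<omega> in M. filterlim (\<lambda>t. X t \<omega>) at_top at_top"
    and s: "0 \<le> s" and A: "A \<in> sets (F s)" "\<And>\<omega>. \<omega> \<in> A \<Longrightarrow> 0 \<le> X s \<omega>"
  shows "measure M (A \<inter> ruined_after s) = C * exp (- \<gamma> * x) * measure Q A"
proof -
  have sets: "A \<inter> ruined s (s + real n) \<in> sets (F (s + real n))" for n
    using F_mono[OF A(1)] ruined_sets[OF s] by auto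
  have "(\<lambda>n. measure M (A \<inter> ruined s (s + real n))) \<longlonglongrightarrow> measure M (\<Union>n. A \<inter> ruined s (s + real n))"
  proof (rule finite_Lim_measure_incseq)
    show "range (\<lambda>n. A \<inter> ruined s (s + real n)) \<subseteq> sets M" using F_subset[OF sets] by blast
    show "incseq (\<lambda>n. A \<inter> ruined s (s + real n))"
      unfolding incseq_def ruined_def by fastforce
  qed
  also have "(\<Union>n. A \<inter> ruined s (s + real n)) = A \<inter> ruined_after s"
    by (auto simp: ruined_after_eq)
  finally have 1: "(\<lambda>n. measure M (A \<inter> ruined s (s + real n))) \<longlonglongrightarrow> measure M (A \<inter> ruined_after s)" .
  have "measure Q (A \<inter> ruined s (s + real n)) = measure Q A - measure Q (A - ruined s (s + real n))" for n
    using Q.finite_measure_Diff'[OF F_subset_Q[OF A(1)] F_subset_Q[OF ruined_sets[of s "s + real n"]]] s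
    by simp
  then have "(\<lambda>n. measure Q (A \<inter> ruined s (s + real n))) \<longlonglongrightarrow> measure Q A - 0"
    using tendsto_diff[OF tendsto_const survival_vanishes_tilted[OF drift s A(1)]] by simp
  then have "(\<lambda>n. C * exp (- \<gamma> * x) * measure Q (A \<inter> ruined s (s + real n)))
      \<longlonglongrightarrow> C * exp (- \<gamma> * x) * (measure Q A - 0)"
    by (intro tendsto_mult tendsto_const)
  moreover have "\<forall>\<^sub>F n in sequentially. C * exp (- \<gamma> * x) * measure Q (A \<inter> ruined s (s + real n)) =
      measure M (A \<inter> ruined s (s + real n))"
    using eventually_gt_at_top[of 0]
    by eventually_elim (subst prob_ruined[OF c s _ refl A], auto)
  ultimately have "(\<lambda>n. measure M (A \<inter> ruined s (s + real n)))
      \<longlonglongrightarrow> C * exp (- \<gamma> * x) * (measure Q A - 0)"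
    by (rule Lim_transform_eventually)
  from LIMSEQ_unique[OF 1 this] show ?thesis by simp
qed

text \<open>
  The event \<open>D\<close> belongs to the past up to every time after \<open>T\<close>, and the density at such times tends on
  \<open>D\<close> to its value at \<open>T\<close>, which is $e^{\<gamma> x}$ as $X(T) = 0$.
\<close>

lemma tilt_at_zero_level:
  assumes T: "0 \<le> T" and D: "\<And>h. 0 < h \<Longrightarrow> D \<in> sets (F (T + h))"
    and zero: "\<And>\<omega>. \<omega> \<in> D \<Longrightarrow> X T \<omega> = 0"
  shows "measure Q D = exp (\<gamma> * x) * measure M D"
proof -
  define u where "u n = T + 1 / (real n + 1)" for n :: nat
  have u: "T \<le> u n" "0 \<le> u n" for n using T by (auto simp: u_def)
  have Du: "D \<in> sets (F (u n))" for n unfolding u_def by (intro D) auto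
  note DM [measurable] = F_subset[OF Du[of 0]]
  have "D \<subseteq> space M" using sets.sets_into_space[OF DM] .
  have ulim: "u \<longlonglongrightarrow> T"
    unfolding u_def using tendsto_add[OF tendsto_const[of T] LIMSEQ_inverse_real_of_nat]
    by (simp add: inverse_eq_divide add.commute)
  have Xlim: "(\<lambda>n. X (u n) \<omega>) \<longlonglongrightarrow> 0" if "\<omega> \<in> D" for \<omega>
    using right_cont_seq[OF right_cont_X T u(1) ulim] that \<open>D \<subseteq> space M\<close> zero[OF that] by (metis subsetD)
  \<comment> \<open>Restricting to levels above $-1$ bounds the density at the times \<open>u n\<close>.\<close>
  define E where "E n = D \<inter> {\<omega> \<in> space M. - 1 \<le> X (u n) \<omega>}" for n
  have [measurable]: "X (u n) \<in> borel_measurable (F (u n))" "X (u n) \<in> borel_measurable M" for n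
    using u by (auto intro: X_F X_M)
  have "{\<omega> \<in> space (F (u n)). - 1 \<le> X (u n) \<omega>} \<in> sets (F (u n))" for n by measurable
  then have E: "E n \<in> sets (F (u n))" for n unfolding E_def using Du[of n] by simp
  note [measurable] = F_subset[OF E]  L_M[OF u(2)]
  note EQ = F_subset_Q[OF E]
  have ev: "\<forall>\<^sub>F n in sequentially. \<omega> \<in> E n" if "\<omega> \<in> D" for \<omega>
    using order_tendstoD(1)[OF Xlim[OF that], of "- 1"] that \<open>D \<subseteq> space M\<close>
    by (auto simp: E_def elim!: eventually_mono)
  have ind: "(\<lambda>n. indicator (E n) \<omega>) \<longlonglongrightarrow> (indicator D \<omega> :: real)" for \<omega>
  proof (cases "\<omega> \<in> D")
    case True
    then show ?thesis
      using ev[OF True] by (intro tendsto_eventually) (auto elim: eventually_mono)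
  qed (auto simp: E_def)
  have "(\<lambda>n. \<integral>\<omega>. indicator (E n) \<omega> \<partial>Q) \<longlonglongrightarrow> (\<integral>\<omega>. indicator D \<omega> \<partial>Q :: real)"
    by (rule integral_dominated_convergence[where w = "\<lambda>_. 1"])
      (use EQ F_subset_Q[OF Du[of 0]] ind in \<open>auto simp: indicator_def\<close>)
  then have 1: "(\<lambda>n. measure Q (E n)) \<longlonglongrightarrow> measure Q D"
    using EQ F_subset_Q[OF Du[of 0]] sets.sets_into_space[OF EQ] \<open>D \<subseteq> space M\<close>
    by (simp add: Int_absorb2)
  have "(\<lambda>n. \<integral>\<omega>. L (u n) \<omega> * indicator (E n) \<omega> \<partial>M) \<longlonglongrightarrow> (\<integral>\<omega>. exp (\<gamma> * x) * indicator D \<omega> \<partial>M)"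
  proof (rule integral_dominated_convergence[where w = "\<lambda>_. exp (\<gamma> * (x + 1))"])
    show "AE \<omega> in M. norm (L (u n) \<omega> * indicator (E n) \<omega>) \<le> exp (\<gamma> * (x + 1))" for n
      using \<gamma>_pos by (intro AE_I2) (auto simp: L_def E_def indicator_def)
    show "AE \<omega> in M. (\<lambda>n. L (u n) \<omega> * indicator (E n) \<omega>) \<longlonglongrightarrow> exp (\<gamma> * x) * indicator D \<omega>"
    proof (intro AE_I2)
      fix \<omega>
      show "(\<lambda>n. L (u n) \<omega> * indicator (E n) \<omega>) \<longlonglongrightarrow> exp (\<gamma> * x) * indicator D \<omega>"
      proof (cases "\<omega> \<in> D")
        case True
        have "(\<lambda>n. L (u n) \<omega> * indicator (E n) \<omega>) \<longlonglongrightarrow> exp (\<gamma> * (x - 0)) * indicator D \<omega>"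
          unfolding L_def by (intro tendsto_intros Xlim[OF True] ind)
        then show ?thesis by simp
      qed (auto simp: E_def)
    qed
  qed auto
  then have "(\<lambda>n. measure Q (E n)) \<longlonglongrightarrow> exp (\<gamma> * x) * measure M D"
    using \<open>D \<subseteq> space M\<close> measure_Q[OF u(2) E] by (simp add: Int_absorb2)
  from LIMSEQ_unique[OF 1 this] show ?thesis .
qed

end

section \<open>Level at ruin without positive jumps\<close>

context tilted_surplus begin

text \<open>
  The surplus is nonnegative before the crossing time and has no negative jump there, so it cannot
  be negative at that time; right continuity excludes a positive level.
\<close>

lemma crossing_eq_0:
  assumes no_jump: "\<forall>t>0. jump (\<lambda>u. S u \<omega>) t \<le> 0"
    and \<omega>: "\<omega> \<in> ruined s t" and s: "0 \<le> s" "0 \<le> X s \<omega>"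
  shows "crossing s t \<omega> = 0"
proof -
  define \<tau> where "\<tau> = Inf {u \<in> {s..t}. X u \<omega> < 0}"
  have \<omega>M: "\<omega> \<in> space M" and ex: "\<exists>u\<in>{s..t}. X u \<omega> < 0" using \<omega> by (auto simp: ruined_def)
  have \<tau>: "s \<le> \<tau>" "\<tau> \<le> t"
    using at_first_neg_tendsto(3,4)[OF right_cont_X[OF \<omega>M] s(1) ex] by (simp_all add: \<tau>_def)
  have "0 \<le> X \<tau> \<omega>"
  proof (cases "\<tau> = s")
    case False
    then have pos: "0 < \<tau>" "s < \<tau>" using \<tau> s by auto
    obtain l where l: "((\<lambda>u. S u \<omega>) \<longlongrightarrow> l) (at_left \<tau>)"
      using S_cadlag[OF \<omega>M] pos by (auto simp: cadlag_def)
    have "0 \<le> X u \<omega>" if "s \<le> u" "u < \<tau>" for u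
    proof (rule ccontr)
      assume "\<not> 0 \<le> X u \<omega>"
      then have "\<tau> \<le> u"
        unfolding \<tau>_def using that \<tau> by (intro cInf_lower) (auto intro: bdd_belowI[of _ s])
      then show False using that by simp
    qed
    then have "S u \<omega> \<le> x + p * u" if "s < u" "u < \<tau>" for u
      using that by (auto simp: surplus_def less_imp_le)
    then have ev: "\<forall>\<^sub>F u in at_left \<tau>. S u \<omega> \<le> x + p * u"
      unfolding eventually_at_left_field using pos by blast
    have "((\<lambda>u. x + p * u) \<longlongrightarrow> x + p * \<tau>) (at_left \<tau>)"
      by (intro tendsto_intros)
    from tendsto_le[OF _ this l ev] have "l \<le> x + p * \<tau>" by simp
    moreover have "S \<tau> \<omega> \<le> l"
      using no_jump pos tendsto_Lim[OF _ l] by (auto simp: jump_def)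
    ultimately show ?thesis by (simp add: surplus_def)
  qed (use s in auto)
  moreover have "X \<tau> \<omega> \<le> 0"
    using crossing_nonpos[OF \<omega> s(1)] by (simp add: crossing_def \<tau>_def)
  ultimately show ?thesis by (simp add: crossing_def \<tau>_def)
qed

lemma overshoot_const_spectrally_negative:
  assumes "spectrally_negative M S"
  shows "overshoot_const (\<lambda>_. 1)"
  unfolding overshoot_const_def
proof (intro allI impI)
  fix m s A and j :: nat
  assume st: "0 \<le> s" "0 < j" and A: "A \<in> sets (F s)" "\<forall>\<omega>\<in>A. 0 \<le> X s \<omega>"
  define t where "t = s + real j"
  let ?B = "A \<inter> ruined s t"
  have st': "s \<le> t" using st by (simp add: t_def)
  have AM [measurable]: "A \<in> sets M" by (rule F_subset[OF A(1)])
  have [measurable]: "ruined s t \<in> sets M" by (rule F_subset[OF ruined_sets[OF st(1) st']])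
  have bound: "\<bar>capped m z\<bar> \<le> exp (real m)" for z
    using capped_nonneg[of m z] capped_le[of m z] by simp
  note lim = integral_grid_level_tendsto[OF st(1) st' AM integrable_const[of 1] capped_cont bound]
  have "(\<lambda>\<omega>. indicator A \<omega> * (indicator (ruined s t) \<omega> * capped m (crossing s t \<omega>)))
      \<in> borel_measurable M"
    by (rule borel_measurable_times[OF _ lim(2)]) measurable
  then have [measurable]: "(\<lambda>\<omega>. indicator ?B \<omega> * capped m (crossing s t \<omega>)) \<in> borel_measurable M"
    by (simp add: indicator_inter_arith mult.assoc)
  have "(\<integral>\<omega>. indicator ?B \<omega> * capped m (crossing s t \<omega>) \<partial>M) = (\<integral>\<omega>. indicator ?B \<omega> \<partial>M)"
  proof (rule integral_cong_AE)
    show "AE \<omega> in M. indicator ?B \<omega> * capped m (crossing s t \<omega>) = indicator ?B \<omega>"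
      using assms unfolding spectrally_negative_def
    proof eventually_elim
      case (elim \<omega>)
      have "capped m (crossing s t \<omega>) = 1" if "\<omega> \<in> ?B"
        using crossing_eq_0[OF elim, of s t] that A st by (auto simp: capped_def)
      then show ?case by (auto simp: indicator_def)
    qed
  qed measurable
  moreover have "?B \<subseteq> space M" by (auto simp: ruined_def)
  ultimately show "(\<lambda>n. 1 * (\<integral>\<omega>. indicator A \<omega> * grid_level (capped m) s (s + real j) n \<omega> \<partial>M))
      \<longlonglongrightarrow> measure M (A \<inter> ruined s (s + real j))"
    using lim(1) unfolding t_def[symmetric] by (simp add: Int_absorb2)
qed

end

section \<open>Independence of an increment from the past\<close>

text \<open>
  A finite set of times in $[0, r]$ placed into one increasing sequence through $0$, $r$ and a
  later time $v$, to bring increments over the gaps into the form used by \<^const>\<open>levy_process\<close>.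
\<close>

lemma increasing_enumeration:
  fixes J :: "real set"
  assumes "finite J" "J \<subseteq> {0..r}" "0 \<le> r" "r \<le> v"
  obtains t :: "nat \<Rightarrow> real" and l i where "mono t" "t 0 = 0" "t l = r" "t (Suc l) = v"
    "\<And>u. u \<in> J \<Longrightarrow> i u \<le> l \<and> t (i u) = u"
proof -
  let ?K = "insert 0 (insert r J)"
  define xs where "xs = sorted_list_of_set ?K"
  define l where "l = length xs - 1"
  define t where "t j = (if j \<le> l then xs ! j else v)" for j
  have set: "set xs = ?K" and sorted: "sorted xs"
    using assms(1) unfolding xs_def by (simp_all del: sorted_list_of_set_insert_remove)
  have len: "length xs = Suc l"
    using set by (cases xs) (auto simp: l_def)
  have K: "?K \<subseteq> {0..r}" using assms by auto
  have nth: "t j \<in> ?K" if "j \<le> l" for j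
    using that len set nth_mem[of j xs] by (simp add: t_def)
  have "mono t"
  proof (rule monoI)
    fix j k :: nat assume "j \<le> k"
    then show "t j \<le> t k"
      using sorted_nth_mono[OF sorted, of j k] len nth[of j] K assms(4)
      by (cases "k \<le> l"; cases "j \<le> l") (auto simp: t_def)
  qed
  have "\<forall>u\<in>?K. \<exists>j\<le>l. t j = u"
    unfolding set[symmetric] by (auto simp: in_set_conv_nth len t_def less_Suc_eq_le)
  then obtain i where i: "\<And>u. u \<in> ?K \<Longrightarrow> i u \<le> l \<and> t (i u) = u" by metis
  show ?thesis
  proof (rule that[of t l i])
    show "t 0 = 0" using monoD[OF \<open>mono t\<close>, of 0 "i 0"] i[of 0] nth[of 0] K by auto
    show "t l = r" using monoD[OF \<open>mono t\<close>, of "i r" l] i[of r] nth[of l] K by auto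
    show "t (Suc l) = v" by (simp add: t_def)
    show "i u \<le> l \<and> t (i u) = u" if "u \<in> J" for u using i[of u] that by simp
  qed fact
qed

lemma levy_increment_indep_finite:
  assumes levy: "levy_process M S" and r: "0 \<le> r" "0 \<le> h"
    and J: "finite J" "J \<subseteq> {0..r}"
    and W: "W \<in> sets (PiM J (\<lambda>_. borel))" and B: "B \<in> sets borel"
  defines "a \<equiv> {\<omega> \<in> space M. (\<lambda>u\<in>J. S u \<omega>) \<in> W}"
    and "b \<equiv> {\<omega> \<in> space M. S (r + h) \<omega> - S r \<omega> \<in> B}"
  shows "measure M (a \<inter> b) = measure M a * measure M b"
proof -
  interpret prob_space M using levy by (simp add: levy_process_def)
  obtain t :: "nat \<Rightarrow> real" and l i where t: "mono t" "t 0 = 0" "t l = r" "t (Suc l) = r + h"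
    and i: "\<And>u. u \<in> J \<Longrightarrow> i u \<le> l \<and> t (i u) = u"
    using increasing_enumeration[OF J r(1), of "r + h"] r(2) by auto
  define D where "D j \<omega> = S (t (Suc j)) \<omega> - S (t j) \<omega>" for j \<omega>
  let ?P = "\<lambda>I. PiM I (\<lambda>_ :: nat. borel :: real measure)"
  let ?R = "\<lambda>I \<omega>. restrict (\<lambda>j. D j \<omega>) I"
  let ?V = "\<lambda>d. \<lambda>u\<in>J. \<Sum>j<i u. d j"
  \<comment> \<open>The first \<open>l\<close> increments determine the values of \<open>S\<close> on \<open>J\<close>; the last one runs from \<open>r\<close> to \<open>r + h\<close>.\<close>
  have "indep_vars (\<lambda>_. borel) D {..<Suc l}"
    using levy t unfolding levy_process_def D_def by auto
  then have ind: "indep_var (?P {..<l}) (?R {..<l}) (?P {l}) (?R {l})"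
    by (rule indep_var_restrict) auto
  have "?V \<in> measurable (?P {..<l}) (PiM J (\<lambda>_. borel))"
  proof (rule measurable_restrict)
    fix u assume "u \<in> J"
    then have "\<And>j. j < i u \<Longrightarrow> j \<in> {..<l}" using i by fastforce
    then show "(\<lambda>d. \<Sum>j<i u. d j) \<in> measurable (?P {..<l}) borel"
      by (intro borel_measurable_sum measurable_component_singleton) auto
  qed
  from measurable_sets[OF this W]
  have W': "?V -` W \<inter> space (?P {..<l}) \<in> sets (?P {..<l})" .
  have B': "(\<lambda>d. d l) -` B \<inter> space (?P {l}) \<in> sets (?P {l})"
    by (intro measurable_sets[OF _ B] measurable_component_singleton) simp
  have V: "?V (?R {..<l} \<omega>) = (\<lambda>u\<in>J. S u \<omega>)" if "\<omega> \<in> space M" for \<omega>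
  proof (rule restrict_ext)
    fix u assume u: "u \<in> J"
    have "(\<Sum>j<i u. ?R {..<l} \<omega> j) = (\<Sum>j<i u. D j \<omega>)"
      using i[OF u] by (intro sum.cong) auto
    also have "\<dots> = S (t (i u)) \<omega> - S (t 0) \<omega>"
      unfolding D_def by (rule sum_lessThan_telescope)
    also have "\<dots> = S u \<omega>"
      using levy i[OF u] t(2) that by (simp add: levy_process_def)
    finally show "(\<Sum>j<i u. ?R {..<l} \<omega> j) = S u \<omega>" .
  qed
  have sp: "?R I \<omega> \<in> space (?P I)" for I \<omega> by (simp add: space_PiM)
  have a: "a = ?R {..<l} -` (?V -` W \<inter> space (?P {..<l})) \<inter> space M"
    unfolding a_def using V sp by auto
  have b: "b = ?R {l} -` ((\<lambda>d. d l) -` B \<inter> space (?P {l})) \<inter> space M"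
    unfolding b_def using sp t by (auto simp: D_def)
  have "a \<inter> b = (\<lambda>\<omega>. (?R {..<l} \<omega>, ?R {l} \<omega>)) -`
      ((?V -` W \<inter> space (?P {..<l})) \<times> ((\<lambda>d. d l) -` B \<inter> space (?P {l}))) \<inter> space M"
    unfolding a b by blast
  then show ?thesis
    using indep_varD[OF ind W' B'] unfolding a b by simp
qed

text \<open>
  From finitely many times to the whole past: the events depending on finitely many times form a
  generator that is closed under intersection.
\<close>

lemma levy_increment_indep:
  assumes levy: "levy_process M S" and r: "0 \<le> r" "0 \<le> h"
    and E: "E \<in> sets (generated_upto M S r)" and B: "B \<in> sets borel"
  shows "measure M (E \<inter> {\<omega> \<in> space M. S (r + h) \<omega> - S r \<omega> \<in> B}) =
     measure M E * measure M {\<omega> \<in> space M. S (r + h) \<omega> - S r \<omega> \<in> B}"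
proof -
  interpret prob_space M using levy by (simp add: levy_process_def)
  have Sm [measurable]: "S u \<in> borel_measurable M" if "0 \<le> u" for u
    using levy that by (simp add: levy_process_def)
  let ?D = "\<lambda>\<omega>. S (r + h) \<omega> - S r \<omega>"
  let ?Y = "\<lambda>J \<omega>. \<lambda>u\<in>J. S u \<omega>"
  let ?P = "\<lambda>J. PiM J (\<lambda>_. borel :: real measure)"
  have D [measurable]: "?D \<in> borel_measurable M" using r by auto
  have Y: "?Y J \<in> measurable M (?P J)" if "J \<subseteq> {0..r}" for J
    using that by (intro measurable_restrict) (auto intro: Sm)
  define G where "G = {?Y J -` W \<inter> space M | J W. finite J \<and> J \<subseteq> {0..r} \<and> W \<in> sets (?P J)}"
  define H where "H = {?D -` B \<inter> space M | B. B \<in> sets borel}"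
  have "Int_stable G"
  proof (rule Int_stableI)
    fix a b assume "a \<in> G" "b \<in> G"
    then obtain J W J' W' where a: "a = ?Y J -` W \<inter> space M" "finite J" "J \<subseteq> {0..r}" "W \<in> sets (?P J)"
      and b: "b = ?Y J' -` W' \<inter> space M" "finite J'" "J' \<subseteq> {0..r}" "W' \<in> sets (?P J')"
      unfolding G_def by blast
    let ?K = "J \<union> J'"
    let ?V = "((\<lambda>f. restrict f J) -` W \<inter> space (?P ?K)) \<inter> ((\<lambda>f. restrict f J') -` W' \<inter> space (?P ?K))"
    have "?V \<in> sets (?P ?K)"
      using a(4) b(4) by (intro sets.Int measurable_sets measurable_restrict_subset) auto
    moreover have "a \<inter> b = ?Y ?K -` ?V \<inter> space M"
      unfolding a(1) b(1) by (auto simp: restrict_restrict Int_absorb1 Int_absorb2 space_PiM)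
    ultimately show "a \<inter> b \<in> G"
      unfolding G_def using a(2,3) b(2,3) by (intro CollectI exI[of _ ?K] exI[of _ ?V]) auto
  qed
  moreover have "Int_stable H"
  proof (rule Int_stableI)
    fix a b assume "a \<in> H" "b \<in> H"
    then obtain B B' where "a = ?D -` B \<inter> space M" "b = ?D -` B' \<inter> space M"
        "B \<in> sets borel" "B' \<in> sets borel"
      unfolding H_def by blast
    then show "a \<inter> b \<in> H"
      unfolding H_def by (intro CollectI exI[of _ "B \<inter> B'"]) auto
  qed
  moreover have "indep_set G H"
    unfolding indep_sets2_eq
  proof (intro conjI ballI)
    show "G \<subseteq> events" unfolding G_def using Y by (auto intro!: measurable_sets)
    show "H \<subseteq> events" unfolding H_def by (auto intro!: measurable_sets[OF D])
    fix a b assume "a \<in> G" "b \<in> H"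
    then obtain J W B where ab: "a = ?Y J -` W \<inter> space M" "b = ?D -` B \<inter> space M"
      and *: "finite J" "J \<subseteq> {0..r}" "W \<in> sets (?P J)" "B \<in> sets borel"
      unfolding G_def H_def by blast
    have "a = {\<omega> \<in> space M. ?Y J \<omega> \<in> W}" "b = {\<omega> \<in> space M. ?D \<omega> \<in> B}"
      using ab by auto
    then show "prob (a \<inter> b) = prob a * prob b"
      using levy_increment_indep_finite[OF levy r *] by (simp only:)
  qed
  ultimately have ind: "indep_set (sigma_sets (space M) G) (sigma_sets (space M) H)"
    by (intro indep_set_sigma_sets)
  have "S u -` B \<inter> space M \<in> G" if u: "0 \<le> u" "u \<le> r" and B: "B \<in> sets borel" for u B
  proof -
    have "(\<lambda>f. f u) -` B \<inter> space (?P {u}) \<in> sets (?P {u})"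
      using B by (intro measurable_sets[OF measurable_component_singleton]) auto
    moreover have "S u -` B \<inter> space M = ?Y {u} -` ((\<lambda>f. f u) -` B \<inter> space (?P {u})) \<inter> space M"
      by (auto simp: space_PiM)
    ultimately show ?thesis
      unfolding G_def using u
      by (intro CollectI exI[of _ "{u}"] exI[of _ "(\<lambda>f. f u) -` B \<inter> space (?P {u})"] conjI) auto
  qed
  then have "sets (generated_upto M S r) \<subseteq> sigma_sets (space M) G"
    unfolding sets_generated_upto by (intro sigma_sets_mono') blast
  then have "E \<in> sigma_sets (space M) G" using E by auto
  moreover have "{\<omega> \<in> space M. ?D \<omega> \<in> B} \<in> sigma_sets (space M) H"
    unfolding H_def using B by (intro sigma_sets.Basic) auto
  ultimately show ?thesis
    using ind unfolding indep_sets2_eq by blast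
qed

section \<open>Compound Poisson laws with exponential claims\<close>

lemma poisson_expectation_power:
  fixes z :: complex
  assumes a: "0 < a"
  shows "(\<integral>n. z ^ n \<partial>measure_pmf (poisson_pmf a)) = exp (of_real a * (z - 1))"
proof -
  let ?f = "\<lambda>n. pmf (poisson_pmf a) n *\<^sub>R z ^ n"
  have f: "?f n = exp (- of_real a) * ((of_real a * z) ^ n /\<^sub>R fact n)" for n
    using a by (simp add: scaleR_conv_of_real power_mult_distrib exp_of_real[symmetric] field_simps
      del: exp_of_real)
  have "integrable (count_space UNIV) ?f"
    unfolding integrable_count_space_nat_iff f norm_mult
    by (intro summable_mult summable_norm_exp)
  then have "?f sums (\<integral>n. ?f n \<partial>count_space UNIV)"
    by (rule sums_integral_count_space_nat)
  moreover have "?f sums (exp (- of_real a) * exp (of_real a * z))"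
    unfolding f by (intro sums_mult exp_converges)
  ultimately have "(\<integral>n. ?f n \<partial>count_space UNIV) = exp (- of_real a) * exp (of_real a * z)"
    by (rule sums_unique2)
  then show ?thesis
    unfolding measure_pmf_eq_density
    by (subst integral_density) (auto simp: exp_add[symmetric] algebra_simps)
qed

text \<open>
  Two claims in a time step have probability of second order in its length. Summed over the steps of
  a grid this tends to 0.
\<close>

lemma poisson_prob_ge_2:
  assumes a: "0 < a"
  shows "measure (measure_pmf (poisson_pmf a)) {2..} \<le> a\<^sup>2"
proof -
  have "measure (measure_pmf (poisson_pmf a)) {0, 1} = exp (- a) * (1 + a)"
    using a by (subst measure_measure_pmf_finite) (auto simp: algebra_simps)
  moreover have "{2..} = UNIV - {0, 1 :: nat}" by auto
  ultimately have "measure (measure_pmf (poisson_pmf a)) {2..} = 1 - exp (- a) * (1 + a)"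
    using measure_pmf.prob_compl[of "{0, 1}" "poisson_pmf a"] by simp
  moreover have "(1 + - a) * (1 + a) \<le> exp (- a) * (1 + a)"
    using a exp_ge_add_one_self[of "- a"] by (intro mult_right_mono) auto
  ultimately show ?thesis by (simp add: power2_eq_square algebra_simps)
qed

text \<open>
  The law of a sum of a Poisson number of claims, with the number taken on a separate factor of a
  product space and hence independent of the claims by construction.
\<close>

definition compound_poisson_law :: "'a measure \<Rightarrow> (nat \<Rightarrow> 'a \<Rightarrow> real) \<Rightarrow> real \<Rightarrow> real measure" where
  "compound_poisson_law M U a =
     distr (measure_pmf (poisson_pmf a) \<Otimes>\<^sub>M M) borel (\<lambda>(n, \<omega>). \<Sum>k<n. U k \<omega>)"

locale exponential_claims = prob_space M for M :: "'a measure" +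
  fixes U :: "nat \<Rightarrow> 'a \<Rightarrow> real" and \<mu> :: real
  assumes \<mu>_pos: "0 < \<mu>"
    and U_indep: "indep_vars (\<lambda>_. borel) U UNIV"
    and U_dist: "\<And>k. distributed M lborel (U k) (exponential_density \<mu>)"
begin

lemma U_measurable [measurable]: "U k \<in> borel_measurable M"
  using U_dist[of k] by (simp add: distributed_def)

lemma AE_U_nonneg: "AE \<omega> in M. \<forall>k. 0 \<le> U k \<omega>"
  unfolding AE_all_countable
proof
  fix k
  have "AE u in density lborel (exponential_density \<mu>). 0 \<le> u"
    by (subst AE_density) (auto simp: exponential_density_def)
  moreover have "distr M lborel (U k) = density lborel (exponential_density \<mu>)"
    using U_dist[of k] unfolding distributed_def by blast
  ultimately have "AE u in distr M lborel (U k). 0 \<le> u" by (simp only:)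
  then show "AE \<omega> in M. 0 \<le> U k \<omega>"
    by (subst (asm) AE_distr_iff) auto
qed

lemma random_sum_measurable [measurable]:
  "(\<lambda>(n, \<omega>). \<Sum>k<n. U k \<omega>) \<in> borel_measurable (measure_pmf (poisson_pmf a) \<Otimes>\<^sub>M M)"
proof -
  have "(\<lambda>(n, \<omega>). \<Sum>k<n. U k \<omega>) \<in> borel_measurable (count_space UNIV \<Otimes>\<^sub>M M)"
    by (rule measurable_pair_measure_countable1) auto
  then show ?thesis
    by (simp cong: measurable_cong_sets add: measurable_cong_sets[OF sets_pair_measure_cong])
qed

lemma real_distribution_compound: "real_distribution (compound_poisson_law M U a)"
proof -
  interpret P: pair_prob_space "measure_pmf (poisson_pmf a)" M ..
  show ?thesis unfolding compound_poisson_law_def by (intro P.real_distribution_distr) measurable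
qed

text \<open>
  Conditioning on the number of claims.
\<close>

lemma integral_compound:
  fixes g :: "real \<Rightarrow> 'b :: {banach, second_countable_topology}"
  assumes [measurable]: "g \<in> borel_measurable borel" and g: "\<And>z. norm (g z) \<le> c"
  shows "(\<integral>z. g z \<partial>compound_poisson_law M U a) =
     (\<integral>n. (\<integral>\<omega>. g (\<Sum>k<n. U k \<omega>) \<partial>M) \<partial>measure_pmf (poisson_pmf a))"
proof -
  interpret P: pair_prob_space "measure_pmf (poisson_pmf a)" M ..
  have m: "(\<lambda>x. g (case x of (n, \<omega>) \<Rightarrow> \<Sum>k<n. U k \<omega>)) \<in>
      borel_measurable (measure_pmf (poisson_pmf a) \<Otimes>\<^sub>M M)"
    by (rule measurable_compose[OF random_sum_measurable assms(1)])
  have i: "integrable (measure_pmf (poisson_pmf a) \<Otimes>\<^sub>M M)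
      (\<lambda>x. g (case x of (n, \<omega>) \<Rightarrow> \<Sum>k<n. U k \<omega>))"
    using g by (intro P.integrable_const_bound[where B = c] m) auto
  have "(\<integral>z. g z \<partial>compound_poisson_law M U a) = (\<integral>x. g (case x of (n, \<omega>) \<Rightarrow> \<Sum>k<n. U k \<omega>)
      \<partial>(measure_pmf (poisson_pmf a) \<Otimes>\<^sub>M M))"
    unfolding compound_poisson_law_def by (rule integral_distr) measurable
  also have "\<dots> = (\<integral>n. (\<integral>\<omega>. g (\<Sum>k<n. U k \<omega>) \<partial>M) \<partial>measure_pmf (poisson_pmf a))"
    using P.integral_fst'[OF i] by (simp only: prod.case)
  finally show ?thesis .
qed

lemma distr_U: "distr M borel (U k) = distr M borel (U 0)"
proof -
  have "distr M lborel (U k) = distr M lborel (U 0)"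
    using U_dist[of k] U_dist[of 0] by (simp add: distributed_def)
  then show ?thesis by (metis distr_cong sets_lborel)
qed

lemma char_compound:
  assumes "0 < a"
  shows "char (compound_poisson_law M U a) \<theta> = exp (of_real a * (char (distr M borel (U 0)) \<theta> - 1))"
proof -
  have "(\<integral>\<omega>. iexp (\<theta> * (\<Sum>k<n. U k \<omega>)) \<partial>M) = char (distr M borel (U 0)) \<theta> ^ n" for n
  proof -
    have "indep_vars (\<lambda>_. borel) U {..<n}" by (rule indep_vars_subset[OF U_indep]) simp
    then have "char (distr M borel (\<lambda>\<omega>. \<Sum>k<n. U k \<omega>)) \<theta> =
        (\<Prod>k<n. char (distr M borel (U k)) \<theta>)"
      by (rule char_distr_sum)
    also have "\<dots> = (\<Prod>k<n. char (distr M borel (U 0)) \<theta>)"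
      by (intro prod.cong refl) (metis distr_U)
    finally have "char (distr M borel (\<lambda>\<omega>. \<Sum>k<n. U k \<omega>)) \<theta> =
        char (distr M borel (U 0)) \<theta> ^ n" by simp
    moreover have "char (distr M borel (\<lambda>\<omega>. \<Sum>k<n. U k \<omega>)) \<theta> =
        (\<integral>\<omega>. iexp (\<theta> * (\<Sum>k<n. U k \<omega>)) \<partial>M)"
      unfolding char_def by (rule integral_distr) measurable
    ultimately show ?thesis by simp
  qed
  then show ?thesis
    unfolding char_def[of "compound_poisson_law M U a"]
    by (subst integral_compound[where c = 1])
      (simp_all add: poisson_expectation_power[OF assms])
qed

text \<open>
  The lack of memory of the exponential distribution, in the form that the overshoot of a claim over
  a level \<open>y\<close> is distributed like a claim and independent of whether the level is exceeded.
\<close>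

lemma memoryless:
  assumes f [measurable]: "f \<in> borel_measurable borel" and bd: "\<And>z. \<bar>f z\<bar> \<le> c" and y: "0 \<le> y"
  shows "(\<integral>\<omega>. (if y < U 0 \<omega> then f (y - U 0 \<omega>) else 0) \<partial>M) =
     exp (- \<mu> * y) * (\<integral>\<omega>. f (- U 0 \<omega>) \<partial>M)"
proof -
  let ?e = "exponential_density \<mu>"
  have e0: "0 \<le> ?e u" for u using \<mu>_pos by (simp add: exponential_density_def)
  have "(\<integral>\<omega>. (if y < U 0 \<omega> then f (y - U 0 \<omega>) else 0) \<partial>M) =
      (\<integral>u. ?e u * (if y < u then f (y - u) else 0) \<partial>lborel)"
    by (rule distributed_integral[OF U_dist, symmetric]) (use e0 in auto)
  also have "\<dots> = (\<integral>v. ?e (y + v) * (if 0 < v then f (- v) else 0) \<partial>lborel)"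
    by (subst lborel_integral_real_affine[of 1 _ y]) (simp_all cong: if_cong)
  also have "\<dots> = (\<integral>v. exp (- \<mu> * y) * (?e v * f (- v)) \<partial>lborel)"
  proof (rule integral_cong_AE)
    have "AE v in lborel. v \<noteq> (0 :: real)" by (rule AE_lborel_singleton)
    then show "AE v in lborel. ?e (y + v) * (if 0 < v then f (- v) else 0) =
        exp (- \<mu> * y) * (?e v * f (- v))"
      by eventually_elim (use y in \<open>auto simp: exponential_density_def exp_add[symmetric] algebra_simps\<close>)
  qed measurable
  also have "\<dots> = exp (- \<mu> * y) * (\<integral>\<omega>. f (- U 0 \<omega>) \<partial>M)"
    using distributed_integral[OF U_dist[of 0], of "\<lambda>v. f (- v)"] e0 by simp
  finally show ?thesis .
qed

text \<open>
  With no claim the level \<open>y\<close> is not exceeded, with a single claim the two terms cancel by the lack of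
  memory, and two or more claims have probability at most $a^2$.
\<close>

lemma overshoot_one_step:
  assumes f [measurable]: "f \<in> borel_measurable borel" and bd: "\<And>z. 0 \<le> f z" "\<And>z. f z \<le> c"
    and y: "0 \<le> y" and a: "0 < a"
  defines "\<Phi> \<equiv> \<integral>\<omega>. f (- U 0 \<omega>) \<partial>M"
  shows "\<bar>\<integral>z. (if y < z then f (y - z) - \<Phi> else 0) \<partial>compound_poisson_law M U a\<bar> \<le> c * a\<^sup>2"
proof -
  have \<Phi>: "0 \<le> \<Phi>" "\<Phi> \<le> c"
  proof -
    show "0 \<le> \<Phi>" unfolding \<Phi>_def by (intro Bochner_Integration.integral_nonneg bd)
    have "\<Phi> \<le> (\<integral>\<omega>. c \<partial>M)" unfolding \<Phi>_def
      using bd order_trans[OF bd] by (intro integral_mono integrable_const_bound[where B = c]) auto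
    then show "\<Phi> \<le> c" by (simp add: prob_space)
  qed
  define g where "g z = (if y < z then f (y - z) - \<Phi> else 0)" for z
  have [measurable]: "g \<in> borel_measurable borel" unfolding g_def by measurable
  have g: "\<bar>g z\<bar> \<le> c" for z
    using bd[of "y - z"] \<Phi> by (auto simp: g_def)
  define G where "G n = (\<integral>\<omega>. g (\<Sum>k<n. U k \<omega>) \<partial>M)" for n :: nat
  have "G 0 = 0" unfolding G_def using y by (simp add: g_def)
  moreover have "G 1 = 0"
  proof -
    have "G 1 = (\<integral>\<omega>. (if y < U 0 \<omega> then f (y - U 0 \<omega>) else 0) -
        (if y < U 0 \<omega> then \<Phi> else 0) \<partial>M)"
      unfolding G_def by (intro Bochner_Integration.integral_cong) (auto simp: g_def)
    also have "\<dots> = (\<integral>\<omega>. (if y < U 0 \<omega> then f (y - U 0 \<omega>) else 0) \<partial>M) -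
        (\<integral>\<omega>. (if y < U 0 \<omega> then \<Phi> else 0) \<partial>M)"
      using bd \<Phi> order_trans[OF bd]
      by (intro Bochner_Integration.integral_diff integrable_const_bound[where B = c]) auto
    also have "\<dots> = 0"
      using memoryless[OF f, of c y] memoryless[of "\<lambda>_. \<Phi>" c y] bd \<Phi> y
      by (simp add: prob_space \<Phi>_def[symmetric] abs_of_nonneg)
    finally show ?thesis .
  qed
  ultimately have small: "G n = 0" if "n < 2" for n
    using that by (cases n) (auto simp: less_Suc_eq)
  have "\<bar>G n\<bar> \<le> c" for n
  proof -
    have "\<bar>G n\<bar> \<le> (\<integral>\<omega>. \<bar>g (\<Sum>k<n. U k \<omega>)\<bar> \<partial>M)" unfolding G_def by (rule integral_abs_bound)
    also have "\<dots> \<le> (\<integral>\<omega>. c \<partial>M)"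
      using g order_trans[OF \<Phi>] by (intro integral_mono integrable_const_bound[where B = c]) auto
    finally show ?thesis by (simp add: prob_space)
  qed
  then have G: "\<bar>G n\<bar> \<le> c * indicator {2..} n" for n
    using small by (auto simp: indicator_def not_le)
  have "\<bar>\<integral>z. g z \<partial>compound_poisson_law M U a\<bar> = \<bar>\<integral>n. G n \<partial>measure_pmf (poisson_pmf a)\<bar>"
    unfolding G_def using g by (subst integral_compound[where c = c]) auto
  also have "\<dots> \<le> (\<integral>n. \<bar>G n\<bar> \<partial>measure_pmf (poisson_pmf a))" by (rule integral_abs_bound)
  also have "\<dots> \<le> (\<integral>n. c * indicator {2..} n \<partial>measure_pmf (poisson_pmf a))"
  proof (rule integral_mono)
    have c: "0 \<le> c" using \<Phi> by simp
    show "integrable (measure_pmf (poisson_pmf a)) (\<lambda>n. \<bar>G n\<bar>)"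
      using G order_trans[OF G, of _ c] c
      by (intro measure_pmf.integrable_const_bound[where B = c] AE_I2) (auto simp: indicator_def)
    show "integrable (measure_pmf (poisson_pmf a)) (\<lambda>n. c * indicator {2..} n)"
      by (intro integrable_mult_right measure_pmf.integrable_const_bound[where B = 1] AE_I2)
        (auto simp: indicator_def)
  qed (rule G)
  also have "\<dots> = c * measure (measure_pmf (poisson_pmf a)) {2..}" by simp
  also have "\<dots> \<le> c * a\<^sup>2"
    using \<Phi> poisson_prob_ge_2[OF a] by (intro mult_left_mono) auto
  finally show ?thesis by (simp add: g_def)
qed

end

section \<open>The law of the compound Poisson process at small times\<close>

text \<open>
  Stationary independent increments turn multiples of the time into powers.
\<close>

lemma levy_char_multiple:
  assumes levy: "levy_process M S" and h: "0 \<le> h"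
  shows "char (distr M borel (S (real j * h))) \<theta> = char (distr M borel (S h)) \<theta> ^ j"
proof -
  interpret prob_space M using levy by (simp add: levy_process_def)
  define D where "D i \<omega> = S (real (Suc i) * h) \<omega> - S (real i * h) \<omega>" for i \<omega>
  have mono: "mono (\<lambda>i. real i * h)" using h by (intro monoI mult_right_mono) auto
  have "\<forall>(t :: nat \<Rightarrow> real) n. 0 \<le> t 0 \<and> mono t \<longrightarrow>
      indep_vars (\<lambda>_. borel) (\<lambda>i \<omega>. S (t (Suc i)) \<omega> - S (t i) \<omega>) {..<n}"
    using levy unfolding levy_process_def by blast
  from spec[OF spec[OF this, of "\<lambda>i. real i * h"], of j] mono
  have "indep_vars (\<lambda>_. borel) D {..<j}"
    unfolding D_def by (simp only: of_nat_0 mult_zero_left order_refl simp_thms)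
  then have "char (distr M borel (\<lambda>\<omega>. \<Sum>i<j. D i \<omega>)) \<theta> = (\<Prod>i<j. char (distr M borel (D i)) \<theta>)"
    by (rule char_distr_sum)
  also have "\<dots> = (\<Prod>i<j. char (distr M borel (S h)) \<theta>)"
  proof (intro prod.cong refl)
    fix i
    have "D i = (\<lambda>\<omega>. S (real i * h + h) \<omega> - S (real i * h) \<omega>)"
      by (simp add: D_def algebra_simps fun_eq_iff)
    moreover have "0 \<le> real i * h" using h by simp
    ultimately show "char (distr M borel (D i)) \<theta> = char (distr M borel (S h)) \<theta>"
      using levy h unfolding levy_process_def by metis
  qed
  also have "distr M borel (\<lambda>\<omega>. \<Sum>i<j. D i \<omega>) = distr M borel (S (real j * h))"
  proof (rule distr_cong[OF refl refl])
    fix \<omega> assume "\<omega> \<in> space M"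
    then have "S 0 \<omega> = 0" using levy by (simp add: levy_process_def)
    then show "(\<Sum>i<j. D i \<omega>) = S (real j * h) \<omega>"
      using sum_lessThan_telescope[of "\<lambda>i. S (real i * h) \<omega>" j] by (simp add: D_def)
  qed
  finally show ?thesis by simp
qed

text \<open>
  A continuous function on the line with finitely many values is constant.
\<close>

lemma continuous_root_of_unity_const:
  fixes g :: "real \<Rightarrow> complex"
  assumes "\<And>\<theta>. isCont g \<theta>" "\<And>\<theta>. g \<theta> ^ n = 1" "g 0 = 1" "0 < n"
  shows "g \<theta> = 1"
proof -
  have "finite {z :: complex. z ^ n = 1}" using assms(4) by (intro finite_roots_unity) simp
  then have "finite (range g)" by (rule finite_subset[rotated]) (use assms(2) in auto)
  then have "g constant_on UNIV"
    using assms(1) by (intro continuous_finite_range_constant)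
      (auto simp: continuous_at_imp_continuous_on)
  then show ?thesis using assms(3) by (metis UNIV_I constant_on_def)
qed

context exponential_claims begin

text \<open>
  The law at time 1 determines the law at time $1/n$: its characteristic function is a continuous
  $n$-th root, equal to 1 at the origin, of a function that does not vanish, and such a root is
  unique.
\<close>

lemma levy_law_at_fraction:
  assumes levy: "levy_process M S" and lam: "0 < lam"
    and law1: "distr M borel (S 1) = compound_poisson_law M U lam"
    and jn: "0 < j" "0 < n"
  shows "distr M borel (S (real j / real n)) = compound_poisson_law M U (lam * (real j / real n))"
proof (rule Levy_uniqueness)
  have S: "S t \<in> borel_measurable M" if "0 \<le> t" for t
    using levy that by (simp add: levy_process_def)
  show "real_distribution (distr M borel (S (real j / real n)))"
    using S by simp
  show "real_distribution (compound_poisson_law M U (lam * (real j / real n)))"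
    by (rule real_distribution_compound)
  let ?\<psi> = "char (distr M borel (U 0))"
  let ?h = "1 / real n"
  interpret U0: real_distribution "distr M borel (U 0)" by simp
  interpret Sh: real_distribution "distr M borel (S ?h)" using S by simp
  \<comment> \<open>The quotient of the characteristic function at time $1/n$ and the expected one is an $n$-th root of
    unity everywhere.\<close>
  define g where "g \<theta> = char (distr M borel (S ?h)) \<theta> * exp (- (of_real (lam * ?h) * (?\<psi> \<theta> - 1)))" for \<theta>
  have "g \<theta> ^ n = 1" for \<theta>
  proof -
    have "char (distr M borel (S ?h)) \<theta> ^ n = char (distr M borel (S 1)) \<theta>"
      using levy_char_multiple[OF levy, of ?h n \<theta>] jn by simp
    also have "\<dots> = exp (of_real lam * (?\<psi> \<theta> - 1))"
      unfolding law1 by (rule char_compound[OF lam])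
    finally show ?thesis
      using jn by (simp add: g_def power_mult_distrib exp_of_nat_mult[symmetric] flip: exp_add)
  qed
  moreover have "isCont g \<theta>" for \<theta>
    unfolding g_def by (intro continuous_intros Sh.isCont_char U0.isCont_char)
  moreover have "g 0 = 1" by (simp add: g_def Sh.char_zero U0.char_zero)
  ultimately have "g \<theta> = 1" for \<theta>
    using continuous_root_of_unity_const jn(2) by blast
  then have h: "char (distr M borel (S ?h)) \<theta> = exp (of_real (lam * ?h) * (?\<psi> \<theta> - 1))" for \<theta>
    by (simp add: g_def exp_minus field_simps)
  show "char (distr M borel (S (real j / real n))) = char (compound_poisson_law M U (lam * (real j / real n)))"
  proof
    fix \<theta>
    have "char (distr M borel (S (real j / real n))) \<theta> = char (distr M borel (S ?h)) \<theta> ^ j"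
      using levy_char_multiple[OF levy, of ?h j \<theta>] by simp
    also have "\<dots> = exp (of_real (lam * (real j / real n)) * (?\<psi> \<theta> - 1))"
      unfolding h by (simp add: exp_of_nat_mult[symmetric] algebra_simps)
    also have "\<dots> = char (compound_poisson_law M U (lam * (real j / real n))) \<theta>"
      using lam jn by (intro char_compound[symmetric]) simp
    finally show "char (distr M borel (S (real j / real n))) \<theta> =
        char (compound_poisson_law M U (lam * (real j / real n))) \<theta>" .
  qed
qed

text \<open>
  Both laws are the mixture, over the values \<open>n\<close> of the count, of the laws of the sums of \<open>n\<close> claims.
\<close>

lemma law_of_random_sum:
  assumes K: "distr M (count_space UNIV) K = measure_pmf (poisson_pmf a)"
    and K_meas: "K \<in> measurable M (count_space UNIV)"
    and indep: "\<And>n B. B \<in> sets borel \<Longrightarrow>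
      prob ({\<omega> \<in> space M. K \<omega> = n} \<inter> {\<omega> \<in> space M. (\<Sum>k<n. U k \<omega>) \<in> B}) =
      prob {\<omega> \<in> space M. K \<omega> = n} * prob {\<omega> \<in> space M. (\<Sum>k<n. U k \<omega>) \<in> B}"
    and Z: "Z \<in> borel_measurable M" "AE \<omega> in M. Z \<omega> = (\<Sum>k<K \<omega>. U k \<omega>)"
  shows "distr M borel Z = compound_poisson_law M U a"
proof (rule measure_eqI)
  show "sets (distr M borel Z) = sets (compound_poisson_law M U a)"
    by (simp add: compound_poisson_law_def)
  fix B assume "B \<in> sets (distr M borel Z)"
  then have B [measurable]: "B \<in> sets borel" by simp
  let ?E = "\<lambda>n. {\<omega> \<in> space M. K \<omega> = n}" and ?G = "\<lambda>n. {\<omega> \<in> space M. (\<Sum>k<n. U k \<omega>) \<in> B}"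
  have E [measurable]: "?E n \<in> sets M" for n
    using measurable_sets[OF K_meas, of "{n}"] by (simp add: vimage_def Int_def conj_commute)
  have G [measurable]: "?G n \<in> sets M" for n by measurable
  have pmf: "pmf (poisson_pmf a) n = prob (?E n)" for n
  proof -
    have "pmf (poisson_pmf a) n = measure (distr M (count_space UNIV) K) {n}"
      unfolding K by (simp add: measure_pmf_single)
    also have "\<dots> = prob (?E n)"
      by (subst measure_distr[OF K_meas]) (auto simp: vimage_def Int_def conj_commute)
    finally show ?thesis .
  qed
  have "emeasure (distr M borel Z) B = emeasure M {\<omega> \<in> space M. Z \<omega> \<in> B}"
    using Z(1) by (subst emeasure_distr) (auto simp: vimage_def Int_def conj_commute)
  also have "\<dots> = emeasure M (\<Union>n. ?E n \<inter> ?G n)"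
  proof (rule emeasure_eq_AE)
    show "AE \<omega> in M. (\<omega> \<in> {\<omega> \<in> space M. Z \<omega> \<in> B}) = (\<omega> \<in> (\<Union>n. ?E n \<inter> ?G n))"
      using Z(2) by eventually_elim auto
  qed (use Z(1) in measurable)
  also have "\<dots> = (\<Sum>n. emeasure M (?E n \<inter> ?G n))"
    by (rule suminf_emeasure[symmetric]) (auto simp: disjoint_family_on_def)
  also have "\<dots> = (\<Sum>n. ennreal (pmf (poisson_pmf a) n) * emeasure M (?G n))"
    unfolding emeasure_eq_measure indep[OF B] pmf by (simp add: ennreal_mult)
  also have "\<dots> = (\<integral>\<^sup>+n. emeasure M (?G n) \<partial>measure_pmf (poisson_pmf a))"
    by (simp add: nn_integral_measure_pmf nn_integral_count_space_nat)
  also have "\<dots> = emeasure (compound_poisson_law M U a) B"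
  proof -
    have "(\<lambda>(n, \<omega>). \<Sum>k<n. U k \<omega>) -` B \<inter> space (measure_pmf (poisson_pmf a) \<Otimes>\<^sub>M M)
        \<in> sets (measure_pmf (poisson_pmf a) \<Otimes>\<^sub>M M)"
      using random_sum_measurable B by (rule measurable_sets)
    then show ?thesis
      unfolding compound_poisson_law_def emeasure_distr[OF random_sum_measurable B]
      by (subst emeasure_pair_measure_alt)
        (auto intro!: nn_integral_cong arg_cong[where f = "emeasure M"] simp: space_pair_measure)
  qed
  finally show "emeasure (distr M borel Z) B = emeasure (compound_poisson_law M U a) B" .
qed

end

text \<open>
  The independence hypothesis in \<^const>\<open>compound_poisson_exponential\<close> speaks about the number of claims
  at integer times: the two families in it share the index type of natural numbers. Hence the law of
  \<open>S\<close> is read off at time 1 and transferred to other times through the increments. The path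
  properties hold because the counting process is right continuous with integer values, hence
  constant for a while after each time.
\<close>

lemma exponential_claims_if_compound_poisson:
  assumes levy: "levy_process M S" and lam: "0 < lam" and \<mu>: "0 < \<mu>"
    and cpe: "compound_poisson_exponential M lam \<mu> S"
  obtains U where "exponential_claims M U \<mu>" "distr M borel (S 1) = compound_poisson_law M U lam"
    "AE \<omega> in M. \<forall>t\<ge>0. 0 \<le> S t \<omega> \<and> (\<exists>v>t. \<forall>u\<in>{t..<v}. S u \<omega> = S t \<omega>)"
proof -
  interpret prob_space M using levy by (simp add: levy_process_def)
  obtain N U where N: "poisson_process M lam N"
    and U: "indep_vars (\<lambda>_. borel) U (UNIV :: nat set)"
      "\<forall>k. distributed M lborel (U k) (exponential_density \<mu>)"
    and indep: "indep_var (PiM {0..} (\<lambda>_. count_space UNIV))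
        (\<lambda>\<omega> i. real ((\<lambda>t\<in>{0..}. N t \<omega>) (real i))) (PiM UNIV (\<lambda>_. borel)) (\<lambda>\<omega> k. U k \<omega>)"
    and S: "AE \<omega> in M. \<forall>t\<ge>0. S t \<omega> = (\<Sum>k<N t \<omega>. U k \<omega>)"
    using cpe unfolding compound_poisson_exponential_def by blast
  have cl: "exponential_claims M U \<mu>"
    using \<mu> U by unfold_locales auto
  then interpret exponential_claims M U \<mu> .
  have levy_N: "levy_process M (\<lambda>t \<omega>. real (N t \<omega>))"
    using N by (simp add: poisson_process_def)
  have N_meas: "N t \<in> measurable M (count_space UNIV)" if "0 \<le> t" for t
  proof -
    have "(\<lambda>\<omega>. real (N t \<omega>)) \<in> borel_measurable M"
      using levy_N that by (simp add: levy_process_def)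
    then have "{\<omega> \<in> space M. real (N t \<omega>) = real n} \<in> sets M" for n by measurable
    then show ?thesis
      by (intro measurable_count_space_eq2_countable[THEN iffD2])
        (auto simp: vimage_def Int_def conj_commute)
  qed
  have law1: "distr M borel (S 1) = compound_poisson_law M U lam"
  proof (rule law_of_random_sum)
    show "distr M (count_space UNIV) (N 1) = measure_pmf (poisson_pmf lam)"
      using N unfolding poisson_process_def by (metis mult.right_neutral zero_less_one)
    show "N 1 \<in> measurable M (count_space UNIV)" by (rule N_meas) simp
    show "S 1 \<in> borel_measurable M" using levy by (simp add: levy_process_def)
    show "AE \<omega> in M. S 1 \<omega> = (\<Sum>k<N 1 \<omega>. U k \<omega>)" using S by eventually_elim simp
    fix n and B :: "real set" assume B: "B \<in> sets borel"
    let ?P = "PiM {0 :: nat..} (\<lambda>_. count_space (UNIV :: real set))"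
    let ?R = "PiM (UNIV :: nat set) (\<lambda>_. borel :: real measure)"
    have 1: "(\<lambda>g. g 1) -` {real n} \<inter> space ?P \<in> sets ?P"
      by (intro measurable_sets[OF measurable_component_singleton]) auto
    have 2: "(\<lambda>g. \<Sum>k<n. g k) -` B \<inter> space ?R \<in> sets ?R"
      by (rule measurable_sets[OF _ B]) measurable
    have "(\<lambda>\<omega> i. real ((\<lambda>t\<in>{0..}. N t \<omega>) (real i))) -` ((\<lambda>g. g 1) -` {real n} \<inter> space ?P) \<inter> space M =
        {\<omega> \<in> space M. N 1 \<omega> = n}"
      by (auto simp: space_PiM)
    moreover have "(\<lambda>\<omega> k. U k \<omega>) -` ((\<lambda>g. \<Sum>k<n. g k) -` B \<inter> space ?R) \<inter> space M =
        {\<omega> \<in> space M. (\<Sum>k<n. U k \<omega>) \<in> B}"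
      by (auto simp: space_PiM)
    moreover have "(\<lambda>\<omega>. (\<lambda>i. real ((\<lambda>t\<in>{0..}. N t \<omega>) (real i)), \<lambda>k. U k \<omega>)) -`
        (((\<lambda>g. g 1) -` {real n} \<inter> space ?P) \<times> ((\<lambda>g. \<Sum>k<n. g k) -` B \<inter> space ?R)) \<inter> space M =
        {\<omega> \<in> space M. N 1 \<omega> = n} \<inter> {\<omega> \<in> space M. (\<Sum>k<n. U k \<omega>) \<in> B}"
      by (auto simp: space_PiM)
    ultimately show "prob ({\<omega> \<in> space M. N 1 \<omega> = n} \<inter> {\<omega> \<in> space M. (\<Sum>k<n. U k \<omega>) \<in> B}) =
        prob {\<omega> \<in> space M. N 1 \<omega> = n} * prob {\<omega> \<in> space M. (\<Sum>k<n. U k \<omega>) \<in> B}"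
      using indep_varD[OF indep 1 2] by (simp only:)
  qed
  have "AE \<omega> in M. \<forall>t\<ge>0. 0 \<le> S t \<omega> \<and> (\<exists>v>t. \<forall>u\<in>{t..<v}. S u \<omega> = S t \<omega>)"
    using S AE_U_nonneg AE_space
  proof eventually_elim
    case (elim \<omega>)
    show ?case
    proof (intro allI impI conjI)
      fix t :: real assume t: "0 \<le> t"
      show "0 \<le> S t \<omega>" using elim t by (auto intro: sum_nonneg)
      have "((\<lambda>u. real (N u \<omega>)) \<longlongrightarrow> real (N t \<omega>)) (at_right t)"
        using levy_N elim(3) t by (auto simp: levy_process_def cadlag_def)
      then have "\<forall>\<^sub>F u in at_right t. dist (real (N u \<omega>)) (real (N t \<omega>)) < 1"
        by (rule tendstoD) simp
      then obtain v where v: "t < v" "\<And>u. t < u \<Longrightarrow> u < v \<Longrightarrow> dist (real (N u \<omega>)) (real (N t \<omega>)) < 1"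
        unfolding eventually_at_right_field by blast
      have "N u \<omega> = N t \<omega>" if "t < u" "u < v" for u
        using v(2)[OF that] by (auto simp: dist_real_def)
      then have "S u \<omega> = S t \<omega>" if "u \<in> {t..<v}" for u
        using that t elim(1) by (cases "u = t") auto
      then show "\<exists>v>t. \<forall>u\<in>{t..<v}. S u \<omega> = S t \<omega>" using v(1) by blast
    qed
  qed
  with cl law1 show ?thesis by (rule that)
qed

section \<open>Level at ruin with exponential claims\<close>

text \<open>
  The one-step estimate from an arbitrary starting level: the increment of \<open>S\<close> is independent of the
  past, so one may integrate over the increment first, with the level at time \<open>r\<close> held fixed.
\<close>

lemma (in tilted_surplus) overshoot_step:
  assumes levy: "levy_process M S" and cl: "exponential_claims M U \<mu>"
    and law: "distr M borel (S h) = compound_poisson_law M U a" and a: "0 < a"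
    and p: "0 \<le> p" and r: "0 \<le> r" "0 \<le> h" and E: "E \<in> sets (F r)" "\<And>\<omega>. \<omega> \<in> E \<Longrightarrow> 0 \<le> X r \<omega>"
    and f [measurable]: "f \<in> borel_measurable borel" and bd: "\<And>z. 0 \<le> f z" "\<And>z. f z \<le> c"
  defines "\<Phi> \<equiv> \<integral>\<omega>. f (- U 0 \<omega>) \<partial>M"
  shows "\<bar>\<integral>\<omega>. indicator E \<omega> * (if X (r + h) \<omega> < 0 then f (X (r + h) \<omega>) - \<Phi> else 0) \<partial>M\<bar> \<le> c * a\<^sup>2"
proof -
  interpret exponential_claims M U \<mu> by (rule cl)
  let ?\<nu> = "compound_poisson_law M U a"
  let ?N = "restr_to_subalg M (F r)"
  let ?D = "\<lambda>\<omega>. S (r + h) \<omega> - S r \<omega>"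
  interpret \<nu>: real_distribution ?\<nu> by (rule real_distribution_compound)
  interpret N: prob_space ?N by (rule prob_space_restr_to_subalg[OF subalgebra_F prob_space_axioms])
  interpret P: pair_prob_space ?N ?\<nu> ..
  have [measurable]: "?D \<in> borel_measurable M" using S_measurable r by auto
  have sets_N: "sets ?N = sets (F r)" by (rule sets_restr_to_subalg[OF subalgebra_F])
  have id: "(\<lambda>\<omega>. \<omega>) \<in> measurable M ?N"
    using subalgebra_F[of r] by (auto simp: measurable_def sets_N subalgebra_def space_restr_to_subalg)
  have pair: "(\<lambda>\<omega>. (\<omega>, ?D \<omega>)) \<in> measurable M (?N \<Otimes>\<^sub>M ?\<nu>)"
    using id by (rule measurable_Pair) (simp cong: measurable_cong_sets)
  have D_law: "distr M borel ?D = ?\<nu>"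
    using levy r law by (simp add: levy_process_def)
  \<comment> \<open>The past and the increment, as a random pair, have the product law.\<close>
  have joint: "?N \<Otimes>\<^sub>M ?\<nu> = distr M (?N \<Otimes>\<^sub>M ?\<nu>) (\<lambda>\<omega>. (\<omega>, ?D \<omega>))"
  proof (rule pair_measure_eqI)
    fix A B assume A: "A \<in> sets ?N" and B: "B \<in> sets ?\<nu>"
    then have A': "A \<in> sets (F r)" and B': "B \<in> sets borel" by (simp_all add: sets_N)
    have "emeasure ?N A = measure M A"
      using emeasure_restr_to_subalg[OF subalgebra_F A'] by (simp add: emeasure_eq_measure)
    moreover have "emeasure ?\<nu> B = measure M {\<omega> \<in> space M. ?D \<omega> \<in> B}"
      unfolding D_law[symmetric] using B'
      by (subst emeasure_distr) (auto simp: emeasure_eq_measure vimage_def Int_def conj_commute)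
    moreover have "emeasure (distr M (?N \<Otimes>\<^sub>M ?\<nu>) (\<lambda>\<omega>. (\<omega>, ?D \<omega>))) (A \<times> B) =
        measure M (A \<inter> {\<omega> \<in> space M. ?D \<omega> \<in> B})"
      using A B sets.sets_into_space[OF A']
      by (subst emeasure_distr[OF pair])
        (auto simp: emeasure_eq_measure intro!: arg_cong[where f = "measure M"])
    ultimately show "emeasure ?N A * emeasure ?\<nu> B =
        emeasure (distr M (?N \<Otimes>\<^sub>M ?\<nu>) (\<lambda>\<omega>. (\<omega>, ?D \<omega>))) (A \<times> B)"
      using levy_increment_indep[OF levy r A' B'] by (simp add: ennreal_mult)
  qed (simp_all add: N.sigma_finite_measure_axioms \<nu>.sigma_finite_measure_axioms)
  define y where "y \<omega> = X r \<omega> + p * h" for \<omega>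
  define G where "G = (\<lambda>(\<omega>, z). indicator E \<omega> * (if y \<omega> < z then f (y \<omega> - z) - \<Phi> else 0))"
  have [measurable]: "y \<in> borel_measurable ?N"
    using X_F[of r r] r unfolding y_def by (auto simp: measurable_cong_sets[OF sets_N refl])
  have [measurable]: "E \<in> sets ?N" using E(1) by (simp add: sets_N)
  have "snd \<in> measurable (?N \<Otimes>\<^sub>M ?\<nu>) borel"
    using measurable_snd[of ?N ?\<nu>] by (simp cong: measurable_cong_sets)
  then have [measurable]: "G \<in> borel_measurable (?N \<Otimes>\<^sub>M ?\<nu>)"
    unfolding G_def case_prod_beta by measurable
  have \<Phi>: "0 \<le> \<Phi>" "\<Phi> \<le> c"
  proof -
    show "0 \<le> \<Phi>" unfolding \<Phi>_def by (intro Bochner_Integration.integral_nonneg bd)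
    have "\<Phi> \<le> (\<integral>\<omega>. c \<partial>M)" unfolding \<Phi>_def
      using bd order_trans[OF bd] by (intro integral_mono integrable_const_bound[where B = c]) auto
    then show "\<Phi> \<le> c" by (simp add: prob_space)
  qed
  have c: "0 \<le> c" using \<Phi> by simp
  have "\<bar>G x\<bar> \<le> c" for x
    using bd[of "y (fst x) - snd x"] \<Phi> c by (auto simp: G_def case_prod_beta indicator_def)
  then have int_G: "integrable (?N \<Otimes>\<^sub>M ?\<nu>) G"
    by (intro P.integrable_const_bound[where B = c]) auto
  have step: "\<bar>\<integral>z. G (\<omega>, z) \<partial>?\<nu>\<bar> \<le> c * a\<^sup>2" for \<omega>
  proof (cases "\<omega> \<in> E")
    case True
    then have "0 \<le> y \<omega>" using E(2) p r by (simp add: y_def)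
    from overshoot_one_step[OF f bd this a, folded \<Phi>_def] show ?thesis
      using True by (simp add: G_def)
  qed (use c in \<open>simp add: G_def\<close>)
  have "(\<integral>\<omega>. indicator E \<omega> * (if X (r + h) \<omega> < 0 then f (X (r + h) \<omega>) - \<Phi> else 0) \<partial>M) =
      (\<integral>\<omega>. G (\<omega>, ?D \<omega>) \<partial>M)"
    by (intro Bochner_Integration.integral_cong refl)
      (simp add: G_def y_def surplus_def algebra_simps)
  also have "\<dots> = (\<integral>x. G x \<partial>(?N \<Otimes>\<^sub>M ?\<nu>))"
    by (subst joint, subst integral_distr[OF pair]) auto
  also have "\<dots> = (\<integral>\<omega>. (\<integral>z. G (\<omega>, z) \<partial>?\<nu>) \<partial>?N)"
    by (rule P.integral_fst'[OF int_G, symmetric])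
  also have "\<bar>\<dots>\<bar> \<le> (\<integral>\<omega>. \<bar>\<integral>z. G (\<omega>, z) \<partial>?\<nu>\<bar> \<partial>?N)"
    by (rule integral_abs_bound)
  also have "\<dots> \<le> (\<integral>\<omega>. c * a\<^sup>2 \<partial>?N)"
    using step P.integrable_fst'[OF int_G] by (intro integral_mono) auto
  finally show ?thesis by (simp add: N.prob_space)
qed

context tilted_surplus begin

text \<open>
  With nonnegative claims the surplus can only grow through the premium.
\<close>

lemma premium_pos:
  assumes drift: "AE \<omega> in M. filterlim (\<lambda>t. X t \<omega>) at_top at_top"
    and nonneg: "AE \<omega> in M. \<forall>t\<ge>0. 0 \<le> S t \<omega>"
  shows "0 < p"
proof (rule ccontr)
  assume p: "\<not> 0 < p"
  from drift nonneg have "AE \<omega> in M. False"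
  proof eventually_elim
    case (elim \<omega>)
    have "\<forall>\<^sub>F t in at_top. x + 1 \<le> X t \<omega>"
      using elim(1) by (simp add: filterlim_at_top)
    then have "\<forall>\<^sub>F t in at_top. x + 1 \<le> X t \<omega> \<and> 0 \<le> t"
      using eventually_ge_at_top[of 0] by eventually_elim simp
    then obtain t where "x + 1 \<le> X t \<omega>" "0 \<le> t"
      unfolding eventually_at_top_linorder by blast
    moreover have "p * t \<le> 0" using p \<open>0 \<le> t\<close> by (simp add: mult_nonpos_nonneg)
    moreover have "0 \<le> S t \<omega>" using elim(2) \<open>0 \<le> t\<close> by blast
    ultimately show False by (simp add: surplus_def)
  qed
  then show False by simp
qed

text \<open>
  The one-step errors are of second order in the step length, and there are $2^n$ steps.
\<close>

lemma overshoot_error: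
  fixes m n :: nat
  assumes levy: "levy_process M S" and cl: "exponential_claims M U \<mu>" and lam: "0 < lam"
    and law1: "distr M borel (S 1) = compound_poisson_law M U lam"
    and p: "0 \<le> p" and s: "0 \<le> s" and j: "0 < j"
    and A: "A \<in> sets (F s)" "\<And>\<omega>. \<omega> \<in> A \<Longrightarrow> 0 \<le> X s \<omega>"
  defines "t \<equiv> s + real j" and "\<Phi> \<equiv> \<integral>\<omega>. capped m (- U 0 \<omega>) \<partial>M"
  shows "\<bar>(\<integral>\<omega>. indicator A \<omega> * grid_level (capped m) s t n \<omega> \<partial>M) -
      \<Phi> * (\<integral>\<omega>. indicator A \<omega> * grid_level (\<lambda>_. 1) s t n \<omega> \<partial>M)\<bar>
      \<le> exp (real m) * (lam * real j)\<^sup>2 / 2 ^ n"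
proof -
  interpret exponential_claims M U \<mu> by (rule cl)
  let ?t = "grid s t n"
  define h where "h = real j / real (2 ^ n)"
  define c where "c = exp (real m)"
  have h: "0 < h" using j by (simp add: h_def)
  have st: "s \<le> t" by (simp add: t_def)
  have tk: "0 \<le> ?t k" "s \<le> ?t k" for k
    using s grid_ge[OF st, of n k] by auto
  have t_Suc: "?t (Suc i) = ?t i + h" for i
    by (simp add: grid_Suc t_def h_def)
  have AM [measurable]: "A \<in> sets M" by (rule F_subset[OF A(1)])
  note [measurable] = X_M[OF tk(1)] grid_level_measurable[OF s st]
  define E where "E i = A \<inter> {\<omega> \<in> space M. \<forall>k\<le>i. 0 \<le> X (?t k) \<omega>}" for i
  have E: "E i \<in> sets (F (?t i))" for i
  proof -
    have "X (?t k) \<in> borel_measurable (F (?t i))" if "k \<le> i" for k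
      using tk grid_mono[OF st that] by (intro X_F) auto
    then have "{\<omega> \<in> space (F (?t i)). 0 \<le> X (?t k) \<omega>} \<in> sets (F (?t i))" if "k \<le> i" for k
      using that by (intro borel_measurable_le) auto
    then have "{\<omega> \<in> space (F (?t i)). \<forall>k\<in>{..i}. 0 \<le> X (?t k) \<omega>} \<in> sets (F (?t i))"
      by (intro sets.sets_Collect_finite_All) auto
    then have "{\<omega> \<in> space M. \<forall>k\<le>i. 0 \<le> X (?t k) \<omega>} \<in> sets (F (?t i))"
      by (simp only: space_generated_upto atMost_iff Ball_def)
    with F_mono[OF A(1) tk(2)] show ?thesis unfolding E_def by (rule sets.Int)
  qed
  note [measurable] = F_subset[OF E]
  define G where "G i \<omega> = indicator (E i) \<omega> *
      (if X (?t i + h) \<omega> < 0 then capped m (X (?t i + h) \<omega>) - \<Phi> else 0)" for i \<omega>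
  have [measurable]: "X (?t i + h) \<in> borel_measurable M" for i
    using tk(1)[of i] h by (intro X_M) simp
  have G_meas [measurable]: "G i \<in> borel_measurable M" for i
    unfolding G_def by measurable
  have bound: "\<bar>capped m z\<bar> \<le> c" for z
    using capped_nonneg[of m z] capped_le[of m z] by (simp add: c_def)
  have "\<bar>G i \<omega>\<bar> \<le> c + \<bar>\<Phi>\<bar>" for i \<omega>
    using bound[of "X (?t i + h) \<omega>"] by (auto simp: G_def indicator_def c_def)
  then have G_int: "integrable M (G i)" for i
    by (intro integrable_const_bound[where B = "c + \<bar>\<Phi>\<bar>"]) auto
  have step: "\<bar>\<integral>\<omega>. G i \<omega> \<partial>M\<bar> \<le> c * (lam * h)\<^sup>2" for i
  proof -
    have "distr M borel (S h) = compound_poisson_law M U (lam * h)"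
      unfolding h_def by (rule levy_law_at_fraction[OF levy lam law1 j]) simp
    from overshoot_step[OF levy cl this _ p tk(1) _ E _ capped_measurable capped_nonneg capped_le]
    show ?thesis
      using lam h unfolding G_def \<Phi>_def c_def by (auto simp: E_def)
  qed
  have int: "integrable M (\<lambda>\<omega>. indicator A \<omega> * grid_level \<phi> s t n \<omega>)"
    if "\<And>z. \<bar>\<phi> z\<bar> \<le> b" "\<phi> \<in> borel_measurable borel" for \<phi> b
  proof (rule integrable_const_bound[where B = b])
    have "0 \<le> b" using that(1)[of 0] by linarith
    then show "AE \<omega> in M. norm (indicator A \<omega> * grid_level \<phi> s t n \<omega>) \<le> b"
      using grid_level_bounded[of \<phi> b] that(1) by (intro AE_I2) (auto simp: indicator_def)
  qed (use that in measurable)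
  have "(\<integral>\<omega>. indicator A \<omega> * grid_level (capped m) s t n \<omega> \<partial>M) -
      \<Phi> * (\<integral>\<omega>. indicator A \<omega> * grid_level (\<lambda>_. 1) s t n \<omega> \<partial>M) =
      (\<integral>\<omega>. indicator A \<omega> * grid_level (capped m) s t n \<omega> -
        \<Phi> * (indicator A \<omega> * grid_level (\<lambda>_. 1) s t n \<omega>) \<partial>M)"
    using int[of "capped m" c] int[of "\<lambda>_. 1" 1] bound by simp
  also have "\<dots> = (\<integral>\<omega>. (\<Sum>i<2 ^ n. G i \<omega>) \<partial>M)"
  proof (intro Bochner_Integration.integral_cong refl)
    fix \<omega> assume \<omega>: "\<omega> \<in> space M"
    show "indicator A \<omega> * grid_level (capped m) s t n \<omega> -
        \<Phi> * (indicator A \<omega> * grid_level (\<lambda>_. 1) s t n \<omega>) = (\<Sum>i<2 ^ n. G i \<omega>)"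
    proof (cases "\<omega> \<in> A")
      case True
      then have "grid_level (\<lambda>z. capped m z - \<Phi>) s t n \<omega> = (\<Sum>i<2 ^ n. G i \<omega>)"
        using A(2)[OF True] \<omega> unfolding at_first_neg_shift[of "\<lambda>u. X u \<omega>", OF A(2)[OF True]]
        by (intro sum.cong) (auto simp: G_def E_def t_Suc indicator_def)
      then show ?thesis using True by (simp add: at_first_neg_diff)
    qed (simp add: G_def E_def)
  qed
  also have "\<dots> = (\<Sum>i<2 ^ n. \<integral>\<omega>. G i \<omega> \<partial>M)"
    using G_int by (rule Bochner_Integration.integral_sum)
  also have "\<bar>\<dots>\<bar> \<le> (\<Sum>i<(2 :: nat) ^ n. c * (lam * h)\<^sup>2)"
    using step by (intro order_trans[OF sum_abs] sum_mono)
  also have "\<dots> = exp (real m) * (lam * real j)\<^sup>2 / 2 ^ n"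
    by (simp add: h_def c_def power2_eq_square)
  finally show ?thesis .
qed

text \<open>
  The constants are the reciprocals of the means \<open>\<Phi> m\<close> of the capped $e^{\<gamma> U}$ for a claim \<open>U\<close>. These means
  are at least 1 and increase with the cap, so the reciprocals converge.
\<close>

lemma overshoot_const_compound_poisson:
  assumes levy: "levy_process M S" and cl: "exponential_claims M U \<mu>" and lam: "0 < lam"
    and law1: "distr M borel (S 1) = compound_poisson_law M U lam" and p: "0 \<le> p"
  obtains c C where "overshoot_const c" "c \<longlonglongrightarrow> C"
proof -
  interpret exponential_claims M U \<mu> by (rule cl)
  define \<Phi> where "\<Phi> m = (\<integral>\<omega>. capped m (- U 0 \<omega>) \<partial>M)" for m
  have int: "integrable M (\<lambda>\<omega>. capped m (- U 0 \<omega>))" for m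
    using capped_nonneg capped_le by (intro integrable_const_bound[where B = "exp (real m)"]) auto
  have ge1: "1 \<le> \<Phi> m" for m
  proof -
    have "(\<integral>\<omega>. 1 \<partial>M) \<le> \<Phi> m"
      unfolding \<Phi>_def
    proof (rule integral_mono_AE)
      show "AE \<omega> in M. 1 \<le> capped m (- U 0 \<omega>)"
        using AE_U_nonneg
      proof eventually_elim
        case (elim \<omega>)
        then show ?case using \<gamma>_pos by (simp add: capped_def)
      qed
    qed (use int in auto)
    then show ?thesis by (simp add: prob_space)
  qed
  have "\<Phi> m \<le> \<Phi> n" if "m \<le> n" for m n
    unfolding \<Phi>_def using that by (intro integral_mono int) (auto simp: capped_def min_def)
  then have "decseq (\<lambda>m. 1 / \<Phi> m)"
    using ge1 by (auto simp: decseq_def intro!: divide_left_mono mult_pos_pos intro: less_le_trans[OF zero_less_one])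
  then obtain C where C: "(\<lambda>m. 1 / \<Phi> m) \<longlonglongrightarrow> C"
    by (rule decseq_convergent[of _ 0]) (use order_trans[OF zero_le_one ge1] in auto)
  have "overshoot_const (\<lambda>m. 1 / \<Phi> m)"
    unfolding overshoot_const_def
  proof (intro allI impI)
    fix m s A and j :: nat
    assume s: "0 \<le> s" and j: "0 < j" and A: "A \<in> sets (F s)" "\<forall>\<omega>\<in>A. 0 \<le> X s \<omega>"
    let ?t = "s + real j"
    let ?I = "\<lambda>\<phi> n. \<integral>\<omega>. indicator A \<omega> * grid_level \<phi> s ?t n \<omega> \<partial>M"
    have "(\<lambda>n. ?I (\<lambda>_. 1) n) \<longlonglongrightarrow> measure M (A \<inter> ruined s ?t)"
    proof -
      have "A \<inter> ruined s ?t \<subseteq> space M" by (auto simp: ruined_def)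
      then show ?thesis
        using integral_grid_level_tendsto(1)[of s ?t A "\<lambda>_. 1" "\<lambda>_. 1" 1] s F_subset[OF A(1)]
        by (simp add: Int_absorb2)
    qed
    moreover have "(\<lambda>n. ?I (capped m) n - \<Phi> m * ?I (\<lambda>_. 1) n) \<longlonglongrightarrow> 0"
    proof (rule Lim_null_comparison)
      have "(\<lambda>n. exp (real m) * (lam * real j)\<^sup>2 * (1 / 2) ^ n) \<longlonglongrightarrow> exp (real m) * (lam * real j)\<^sup>2 * 0"
        by (intro tendsto_mult tendsto_const LIMSEQ_power_zero) simp
      then show "(\<lambda>n. exp (real m) * (lam * real j)\<^sup>2 / 2 ^ n) \<longlonglongrightarrow> 0"
        by (simp add: power_divide)
      show "\<forall>\<^sub>F n in sequentially. norm (?I (capped m) n - \<Phi> m * ?I (\<lambda>_. 1) n)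
          \<le> exp (real m) * (lam * real j)\<^sup>2 / 2 ^ n"
        using overshoot_error[OF levy cl lam law1 p s j A(1)] A(2)
        by (intro always_eventually) (auto simp: \<Phi>_def)
    qed
    ultimately have "(\<lambda>n. 1 / \<Phi> m * ((?I (capped m) n - \<Phi> m * ?I (\<lambda>_. 1) n) + \<Phi> m * ?I (\<lambda>_. 1) n))
        \<longlonglongrightarrow> 1 / \<Phi> m * (0 + \<Phi> m * measure M (A \<inter> ruined s ?t))"
      by (intro tendsto_intros)
    moreover have "\<Phi> m \<noteq> 0" using ge1[of m] by auto
    ultimately show "(\<lambda>n. 1 / \<Phi> m * ?I (capped m) n) \<longlonglongrightarrow> measure M (A \<inter> ruined s ?t)"
      by simp
  qed
  then show ?thesis using C by (rule that)
qed

end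

section \<open>Ruin exactly at a given time\<close>

context tilted_surplus begin

text \<open>
  Ruin time at most \<open>T\<close> although no negative value occurs up to \<open>T\<close>: the surplus is zero at \<open>T\<close> and takes
  negative values immediately afterwards.
\<close>

definition ruin_at_once_after :: "real \<Rightarrow> 'a set" where
  "ruin_at_once_after T = {\<omega> \<in> space M. ruin_time S p x \<omega> \<le> ereal T} - ruined 0 T"

lemma ruin_time_finite_iff: "ruin_time S p x \<omega> < \<infinity> \<longleftrightarrow> (\<exists>t\<ge>0. X t \<omega> < 0)"
  unfolding ruin_time_def Inf_less_iff by auto

lemma ruin_time_le_iff:
  "ruin_time S p x \<omega> \<le> ereal T \<longleftrightarrow> (\<forall>v>T. \<exists>t\<in>{0..v}. X t \<omega> < 0)"
proof
  assume le: "ruin_time S p x \<omega> \<le> ereal T"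
  show "\<forall>v>T. \<exists>t\<in>{0..v}. X t \<omega> < 0"
  proof (intro allI impI)
    fix v assume "T < v"
    with le have "ruin_time S p x \<omega> < ereal v" by (meson ereal_less_eq(3) le_less_trans less_ereal.simps(1))
    then show "\<exists>t\<in>{0..v}. X t \<omega> < 0"
      unfolding ruin_time_def Inf_less_iff by (auto intro: less_imp_le)
  qed
next
  assume *: "\<forall>v>T. \<exists>t\<in>{0..v}. X t \<omega> < 0"
  show "ruin_time S p x \<omega> \<le> ereal T"
  proof (rule ccontr)
    assume "\<not> ruin_time S p x \<omega> \<le> ereal T"
    then obtain v where v: "T < v" "ereal v < ruin_time S p x \<omega>"
      using ereal_dense2[of "ereal T" "ruin_time S p x \<omega>"] by (auto simp: not_le)
    obtain t where t: "t \<in> {0..v}" "X t \<omega> < 0" using * v(1) by blast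
    then have "ruin_time S p x \<omega> \<le> ereal t"
      unfolding ruin_time_def by (intro Inf_lower) auto
    also have "\<dots> \<le> ereal v" using t by simp
    finally show False using v(2) by simp
  qed
qed

lemma ruined_subset_ruin_time_le: "ruined 0 T \<subseteq> {\<omega> \<in> space M. ruin_time S p x \<omega> \<le> ereal T}"
proof
  fix \<omega> assume \<omega>: "\<omega> \<in> ruined 0 T"
  then obtain t where "t \<in> {0..T}" "X t \<omega> < 0" by (auto simp: ruined_def)
  then have "\<forall>v>T. \<exists>t\<in>{0..v}. X t \<omega> < 0" by force
  then show "\<omega> \<in> {\<omega> \<in> space M. ruin_time S p x \<omega> \<le> ereal T}"
    using \<omega> by (simp add: ruin_time_le_iff ruined_def)
qed

lemma ruin_time_le_eq:
  "{\<omega> \<in> space M. ruin_time S p x \<omega> \<le> ereal T} = ruined 0 T \<union> ruin_at_once_after T"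
  using ruined_subset_ruin_time_le by (auto simp: ruin_at_once_after_def)

lemma ruin_at_once_afterD:
  assumes "\<omega> \<in> ruin_at_once_after T" "0 \<le> T"
  shows "X T \<omega> = 0" and "\<And>v. T < v \<Longrightarrow> \<exists>u\<in>{T..<v}. X u \<omega> < 0"
proof -
  have \<omega>: "\<omega> \<in> space M" and neg: "\<And>v. T < v \<Longrightarrow> \<exists>t\<in>{0..v}. X t \<omega> < 0"
    and nonneg: "\<And>t. t \<in> {0..T} \<Longrightarrow> 0 \<le> X t \<omega>"
    using assms(1) by (auto simp: ruin_at_once_after_def ruin_time_le_iff ruined_def not_less)
  show *: "\<exists>u\<in>{T..<v}. X u \<omega> < 0" if v: "T < v" for v
  proof -
    obtain u where u: "u \<in> {0..(T + v) / 2}" "X u \<omega> < 0" using neg[of "(T + v) / 2"] v by auto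
    then have "\<not> u \<le> T" using nonneg[of u] by force
    moreover have "(T + v) / 2 < v" using v by simp
    ultimately show ?thesis using u by (intro bexI[of _ u]) auto
  qed
  have "\<not> 0 < X T \<omega>"
  proof
    assume "0 < X T \<omega>"
    moreover have "((\<lambda>u. X u \<omega>) \<longlongrightarrow> X T \<omega>) (at_right T)"
      using right_cont_X[OF \<omega>] assms(2) by (simp add: right_cont_def)
    ultimately have "\<forall>\<^sub>F u in at_right T. 0 < X u \<omega>" by (intro order_tendstoD)
    then obtain v where v: "T < v" "\<And>u. T < u \<Longrightarrow> u < v \<Longrightarrow> 0 < X u \<omega>"
      unfolding eventually_at_right_field by blast
    obtain u where "u \<in> {T..<v}" "X u \<omega> < 0" using *[OF v(1)] by blast
    then show False using v(2)[of u] \<open>0 < X T \<omega>\<close> by (cases "u = T") auto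
  qed
  then show "X T \<omega> = 0" using nonneg[of T] assms(2) by simp
qed

text \<open>
  The event looks beyond \<open>T\<close>, but by an arbitrarily short time only.
\<close>

lemma ruin_at_once_after_sets:
  assumes T: "0 \<le> T" and h: "0 < h"
  shows "ruin_at_once_after T \<in> sets (F (T + h))"
proof -
  let ?v = "\<lambda>n. T + h / real (Suc n)"
  have "{\<omega> \<in> space M. ruin_time S p x \<omega> \<le> ereal T} = (\<Inter>n. ruined 0 (?v n))"
  proof (intro equalityI subsetI)
    fix \<omega> assume "\<omega> \<in> {\<omega> \<in> space M. ruin_time S p x \<omega> \<le> ereal T}"
    then show "\<omega> \<in> (\<Inter>n. ruined 0 (?v n))"
      using h by (auto simp: ruin_time_le_iff ruined_def)
  next
    fix \<omega> assume \<omega>: "\<omega> \<in> (\<Inter>n. ruined 0 (?v n))"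
    have "\<exists>t\<in>{0..v}. X t \<omega> < 0" if "T < v" for v
    proof -
      obtain n where "h / (v - T) < real (Suc n)" using reals_Archimedean2 less_trans of_nat_less_iff lessI by metis
      then have "?v n \<le> v" using that by (simp add: field_simps)
      moreover have "\<exists>t\<in>{0..?v n}. X t \<omega> < 0" using \<omega> by (auto simp: ruined_def)
      ultimately show ?thesis by force
    qed
    then show "\<omega> \<in> {\<omega> \<in> space M. ruin_time S p x \<omega> \<le> ereal T}"
      using \<omega> by (auto simp: ruin_time_le_iff ruined_def)
  qed
  moreover have "ruined 0 (?v n) \<in> sets (F (T + h))" for n
  proof (rule F_mono[OF ruined_sets])
    show "?v n \<le> T + h" using h by (simp add: field_simps)
  qed (use T h in auto)
  moreover have "ruined 0 T \<in> sets (F (T + h))"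
    using F_mono[OF ruined_sets[of 0 T]] T h by auto
  ultimately show ?thesis
    unfolding ruin_at_once_after_def by (auto intro!: sets.Diff sets.countable_INT)
qed

lemma ruin_prob_eq: "ruin_prob M S p x = measure M (ruined_after 0)"
  unfolding ruin_prob_def ruined_after_def ruin_time_finite_iff ..

lemma ruin_prob_by_eq:
  assumes T: "0 \<le> T"
  shows "ruin_prob_by M S p x T = measure M (ruined 0 T) + measure M (ruin_at_once_after T)"
    and "ruin_prob_by Q S p x T = measure Q (ruined 0 T) + measure Q (ruin_at_once_after T)"
proof -
  have disj: "ruined 0 T \<inter> ruin_at_once_after T = {}" by (auto simp: ruin_at_once_after_def)
  note F = ruined_sets[OF order_refl T] ruin_at_once_after_sets[OF T zero_less_one]
  show "ruin_prob_by M S p x T = measure M (ruined 0 T) + measure M (ruin_at_once_after T)"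
    unfolding ruin_prob_by_def ruin_time_le_eq
    by (rule finite_measure_Union[OF F[THEN F_subset] disj])
  show "ruin_prob_by Q S p x T = measure Q (ruined 0 T) + measure Q (ruin_at_once_after T)"
    unfolding ruin_prob_by_def space_Q ruin_time_le_eq
    by (rule Q.finite_measure_Union[OF F[THEN F_subset_Q] disj])
qed

lemma late_ruin_prob_eq:
  assumes T: "0 \<le> T"
  shows "late_ruin_prob M S p x T + measure M (ruin_at_once_after T) =
     measure M ((space M - ruined 0 T) \<inter> ruined_after T)"
proof -
  let ?D = "ruin_at_once_after T"
  let ?B = "(space M - ruined 0 T) \<inter> ruined_after T"
  have "?D \<subseteq> ?B"
  proof
    fix \<omega> assume \<omega>: "\<omega> \<in> ?D"
    obtain u where "u \<in> {T..<T + 1}" "X u \<omega> < 0"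
      using ruin_at_once_afterD(2)[OF \<omega> T, of "T + 1"] by auto
    then show "\<omega> \<in> ?B"
      using \<omega> unfolding ruin_at_once_after_def ruined_after_def by auto
  qed
  moreover have "{\<omega> \<in> space M. ereal T < ruin_time S p x \<omega> \<and> ruin_time S p x \<omega> < \<infinity>} = ?B - ?D"
  proof -
    have late: "ereal T < ruin_time S p x \<omega> \<longleftrightarrow> \<omega> \<notin> ruined 0 T \<union> ?D" if "\<omega> \<in> space M" for \<omega>
      unfolding ruin_time_le_eq[symmetric] using that by (simp add: not_le)
    have finite: "ruin_time S p x \<omega> < \<infinity> \<longleftrightarrow> \<omega> \<in> ruined_after T"
      if "\<omega> \<in> space M" "\<omega> \<notin> ruined 0 T" for \<omega>
    proof -
      have "T \<le> t" if "0 \<le> t" "X t \<omega> < 0" for t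
        using that \<open>\<omega> \<notin> ruined 0 T\<close> \<open>\<omega> \<in> space M\<close> by (force simp: ruined_def)
      then show ?thesis
        using T \<open>\<omega> \<in> space M\<close> unfolding ruin_time_finite_iff ruined_after_def
        by (auto intro: order_trans)
    qed
    show ?thesis using late finite by auto
  qed
  moreover have "?D \<in> sets M" using F_subset[OF ruin_at_once_after_sets[OF T zero_less_one]] .
  moreover have "?B \<in> sets M"
    using F_subset[OF ruined_sets[OF order_refl T]] ruined_after_sets[OF T] by auto
  ultimately show ?thesis
    unfolding late_ruin_prob_def using finite_measure_Diff[of ?B ?D] by simp
qed

text \<open>
  After \<open>T\<close> there is no claim for a while, and the premium makes the surplus increase.
\<close>

lemma ruin_at_once_after_null:
  assumes levy: "levy_process M S" and lam: "0 < lam" "0 < \<mu>"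
    and cpe: "compound_poisson_exponential M lam \<mu> S"
    and drift: "AE \<omega> in M. filterlim (\<lambda>t. X t \<omega>) at_top at_top" and T: "0 \<le> T"
  shows "measure M (ruin_at_once_after T) = 0"
proof -
  obtain U where path: "AE \<omega> in M. \<forall>t\<ge>0. 0 \<le> S t \<omega> \<and> (\<exists>v>t. \<forall>u\<in>{t..<v}. S u \<omega> = S t \<omega>)"
    using exponential_claims_if_compound_poisson[OF levy lam cpe] by metis
  then have "AE \<omega> in M. \<forall>t\<ge>0. 0 \<le> S t \<omega>" by eventually_elim blast
  then have p: "0 < p" by (rule premium_pos[OF drift])
  have "AE \<omega> in M. \<omega> \<notin> ruin_at_once_after T"
    using path
  proof eventually_elim
    case (elim \<omega>)
    then obtain v where v: "T < v" "\<And>u. u \<in> {T..<v} \<Longrightarrow> S u \<omega> = S T \<omega>" using T by blast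
    show ?case
    proof
      assume \<omega>: "\<omega> \<in> ruin_at_once_after T"
      obtain u where u: "u \<in> {T..<v}" "X u \<omega> < 0"
        using ruin_at_once_afterD(2)[OF \<omega> T v(1)] by blast
      moreover have "X u \<omega> = X T \<omega> + p * (u - T)"
        using v(2)[OF u(1)] by (simp add: surplus_def algebra_simps)
      moreover have "0 \<le> p * (u - T)" using p u(1) by simp
      ultimately show False using ruin_at_once_afterD(1)[OF \<omega> T] by simp
    qed
  qed
  then show ?thesis
    using F_subset[OF ruin_at_once_after_sets[OF T zero_less_one]]
    by (simp add: AE_iff_measurable measure_def AE_iff_null_sets null_setsD1)
qed

text \<open>
  The two ways in which ruin probabilities turn into probabilities under the tilted measure. In the
  first, taking for \<open>A\<close> the whole space and $s = 0$ identifies \<open>ruin_prob M S p x\<close> with $C e^{-\<gamma> x}$.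
  The second is used for ruin exactly at \<open>T\<close>: either the event is null or $C = 1$.
\<close>

lemma ruin_after_eq_tilted:
  assumes levy: "levy_process M S"
    and kind: "spectrally_negative M S \<or>
      (\<exists>lam>0. \<exists>\<mu>>0. compound_poisson_exponential M lam \<mu> S)"
    and drift: "AE \<omega> in M. filterlim (\<lambda>t. X t \<omega>) at_top at_top" and x: "0 \<le> x"
  shows "\<And>s A. 0 \<le> s \<Longrightarrow> A \<in> sets (F s) \<Longrightarrow> (\<And>\<omega>. \<omega> \<in> A \<Longrightarrow> 0 \<le> X s \<omega>) \<Longrightarrow>
      measure M (A \<inter> ruined_after s) = ruin_prob M S p x * measure Q A"
    and "\<And>T D. 0 \<le> T \<Longrightarrow> (\<And>h. 0 < h \<Longrightarrow> D \<in> sets (F (T + h))) \<Longrightarrow> (\<And>\<omega>. \<omega> \<in> D \<Longrightarrow> X T \<omega> = 0) \<Longrightarrow>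
      ((\<exists>lam>0. \<exists>\<mu>>0. compound_poisson_exponential M lam \<mu> S) \<Longrightarrow> measure M D = 0) \<Longrightarrow>
      measure M D = ruin_prob M S p x * measure Q D"
proof -
  obtain c C where c: "overshoot_const c" "c \<longlonglongrightarrow> C"
    and C: "C = 1 \<or> (\<exists>lam>0. \<exists>\<mu>>0. compound_poisson_exponential M lam \<mu> S)"
    using kind
  proof
    assume "spectrally_negative M S"
    then show ?thesis
      using that[OF overshoot_const_spectrally_negative tendsto_const] by blast
  next
    assume cpe: "\<exists>lam>0. \<exists>\<mu>>0. compound_poisson_exponential M lam \<mu> S"
    then obtain lam \<mu> where lam: "0 < lam" "0 < \<mu>" "compound_poisson_exponential M lam \<mu> S" by blast
    obtain U where U: "exponential_claims M U \<mu>" "distr M borel (S 1) = compound_poisson_law M U lam"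
      and path: "AE \<omega> in M. \<forall>t\<ge>0. 0 \<le> S t \<omega> \<and> (\<exists>v>t. \<forall>u\<in>{t..<v}. S u \<omega> = S t \<omega>)"
      by (rule exponential_claims_if_compound_poisson[OF levy lam])
    from path have "AE \<omega> in M. \<forall>t\<ge>0. 0 \<le> S t \<omega>" by eventually_elim blast
    then have "0 < p" by (rule premium_pos[OF drift])
    then obtain c C where "overshoot_const c" "c \<longlonglongrightarrow> C"
      using overshoot_const_compound_poisson[OF levy U(1) lam(1) U(2)] by (metis less_imp_le)
    then show ?thesis using that cpe by blast
  qed
  note after = prob_ruined_after[OF c drift]
  have "space M \<inter> ruined_after 0 = ruined_after 0" by (auto simp: ruined_after_def)
  moreover have "0 \<le> X 0 \<omega>" if "\<omega> \<in> space M" for \<omega>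
    using x levy that by (simp add: surplus_def levy_process_def)
  moreover have "space M \<in> sets (F 0)" using sets.top[of "F 0"] by simp
  ultimately have \<psi>: "ruin_prob M S p x = C * exp (- \<gamma> * x)"
    using after[of 0 "space M"] Q.prob_space by (simp add: ruin_prob_eq)
  show "measure M (A \<inter> ruined_after s) = ruin_prob M S p x * measure Q A"
    if "0 \<le> s" "A \<in> sets (F s)" "\<And>\<omega>. \<omega> \<in> A \<Longrightarrow> 0 \<le> X s \<omega>" for s A
    unfolding \<psi> by (rule after[OF that])
  show "measure M D = ruin_prob M S p x * measure Q D"
    if "0 \<le> T" "\<And>h. 0 < h \<Longrightarrow> D \<in> sets (F (T + h))" "\<And>\<omega>. \<omega> \<in> D \<Longrightarrow> X T \<omega> = 0"
      "(\<exists>lam>0. \<exists>\<mu>>0. compound_poisson_exponential M lam \<mu> S) \<Longrightarrow> measure M D = 0" for T D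
    using tilt_at_zero_level[OF that(1-3)] C that(4) unfolding \<psi>
    by (auto simp flip: exp_add)
qed

end

section \<open>The two-dimensional ruin probabilities\<close>

theorem corollary1:
  fixes M Q1 Q2 :: "'a measure"
    and S :: "real \<Rightarrow> 'a \<Rightarrow> real"
    and p1 p2 x1 x2 \<gamma>1 \<gamma>2 T :: real
  assumes levy: "levy_process M S"
    and kind: "spectrally_negative M S \<or>
      (\<exists>lam>0. \<exists>\<mu>>0. compound_poisson_exponential M lam \<mu> S)"
    and rates: "p1 > p2"
    and initial: "0 \<le> x1" "0 \<le> x2" "x2 > x1"
    and drift1: "AE \<omega> in M. filterlim (\<lambda>t. surplus S p1 x1 t \<omega>) at_top at_top"
    and drift2: "AE \<omega> in M. filterlim (\<lambda>t. surplus S p2 x2 t \<omega>) at_top at_top"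
    and not_monotone1:
      "\<not> (AE \<omega> in M. mono_on {0..} (\<lambda>t. surplus S p1 x1 t \<omega>))"
      "\<not> (AE \<omega> in M. antimono_on {0..} (\<lambda>t. surplus S p1 x1 t \<omega>))"
    and not_monotone2:
      "\<not> (AE \<omega> in M. mono_on {0..} (\<lambda>t. surplus S p2 x2 t \<omega>))"
      "\<not> (AE \<omega> in M. antimono_on {0..} (\<lambda>t. surplus S p2 x2 t \<omega>))"
    and gamma1: "adjustment_coefficient M S p1 \<gamma>1"
    and gamma2: "adjustment_coefficient M S p2 \<gamma>2"
    and Q1: "tilted_measure M S p1 (-\<gamma>1) Q1"
    and Q2: "tilted_measure M S p2 (-\<gamma>2) Q2"
    and T: "T = (x2 - x1) / (p1 - p2)"
  shows "(ruin_sim M S p1 p2 x1 x2 =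
           ruin_prob_by M S p2 x2 T + ruin_prob M S p1 x1 * survival_prob_until Q1 S p2 x2 T) \<and>
         (ruin_or M S p1 p2 x1 x2 =
           ruin_prob_by M S p1 x1 T + ruin_prob M S p2 x2 * survival_prob_until Q2 S p1 x1 T) \<and>
         (ruin_and M S p1 p2 x1 x2 =
           late_ruin_prob M S p1 x1 T + ruin_prob M S p2 x2 * ruin_prob_by Q2 S p1 x1 T)"
proof -
  have prob: "prob_space M" and S_meas: "\<And>t. 0 \<le> t \<Longrightarrow> S t \<in> borel_measurable M"
    and S_cadlag: "\<And>\<omega>. \<omega> \<in> space M \<Longrightarrow> cadlag (\<lambda>t. S t \<omega>)"
    using levy unfolding levy_process_def by blast+
  interpret I1: tilted_surplus M Q1 S p1 x1 \<gamma>1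
    by (rule tilted_surplus.intro[OF prob S_meas S_cadlag gamma1 Q1])
  interpret I2: tilted_surplus M Q2 S p2 x2 \<gamma>2
    by (rule tilted_surplus.intro[OF prob S_meas S_cadlag gamma2 Q2])
  let ?X1 = "surplus S p1 x1" and ?X2 = "surplus S p2 x2" and ?F = "generated_upto M S"
  have T_pos: "0 < T" using initial rates by (simp add: T)
  then have T0: "0 \<le> T" by simp
  have "(p1 - p2) * T = x2 - x1" using rates by (simp add: T)
  then have diff: "?X1 t \<omega> - ?X2 t \<omega> = (p1 - p2) * (t - T)" for t \<omega>
    by (simp add: surplus_def algebra_simps)
  \<comment> \<open>The ordering of the two paths changes at \<open>T\<close>.\<close>
  have before: "?X1 t \<omega> \<le> ?X2 t \<omega>" if "t \<le> T" for t \<omega>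
    using diff[of t \<omega>] rates that mult_nonneg_nonpos[of "p1 - p2" "t - T"] by simp
  have after: "?X2 t \<omega> \<le> ?X1 t \<omega>" if "T \<le> t" for t \<omega>
  proof -
    have "0 \<le> (p1 - p2) * (t - T)" using rates that by simp
    then show ?thesis using diff[of t \<omega>] by linarith
  qed
  have at_T: "?X1 T \<omega> = ?X2 T \<omega>" for \<omega> using diff[of T \<omega>] by simp

  define A1 A2 where "A1 = I1.ruined 0 T" and "A2 = I2.ruined 0 T"
  define D1 D2 where "D1 = I1.ruin_at_once_after T" and "D2 = I2.ruin_at_once_after T"
  define R1 R2 where "R1 = I1.ruined_after T" and "R2 = I2.ruined_after T"
  let ?\<psi>1 = "ruin_prob M S p1 x1" and ?\<psi>2 = "ruin_prob M S p2 x2"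
  note sets_A = I1.ruined_sets[OF order_refl T0, folded A1_def] I2.ruined_sets[OF order_refl T0, folded A2_def]
  note sets_D = I1.ruin_at_once_after_sets[OF T0, folded D1_def] I2.ruin_at_once_after_sets[OF T0, folded D2_def]
  note M_A [measurable] = sets_A[THEN I1.F_subset]
  note M_R [measurable] = I1.ruined_after_sets[OF T0, folded R1_def] I2.ruined_after_sets[OF T0, folded R2_def]
  have compl: "space M - E \<in> sets (?F T)" if "E \<in> sets (?F T)" for E
    using sets.compl_sets[OF that] by simp
  have A_nonneg: "0 \<le> ?X1 T \<omega>" if "\<omega> \<in> space M - A1 \<or> \<omega> \<in> space M - A2" for \<omega>
  proof -
    have "\<omega> \<in> A1 \<and> \<omega> \<in> A2" if "\<omega> \<in> space M" "?X1 T \<omega> < 0"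
      using that T0 at_T[of \<omega>] unfolding A1_def A2_def I1.ruined_def I2.ruined_def
      by (auto intro!: bexI[of _ T])
    then show ?thesis using that by fastforce
  qed
  have A2_A1: "A2 \<subseteq> A1"
    using before le_less_trans unfolding A1_def A2_def I1.ruined_def I2.ruined_def by fastforce

  note tilt1 = I1.ruin_after_eq_tilted[OF levy kind drift1 initial(1)]
  note tilt2 = I2.ruin_after_eq_tilted[OF levy kind drift2 initial(2)]
  \<comment> \<open>Ruin from \<open>T\<close> on, after an event of the past on which the common level at \<open>T\<close> is nonnegative.\<close>
  have later1: "measure M ((space M - A2) \<inter> R1) = ?\<psi>1 * measure Q1 (space M - A2)"
    unfolding R1_def using A_nonneg by (intro tilt1(1) T0 compl sets_A) auto
  have later2: "measure M (E \<inter> R2) = ?\<psi>2 * measure Q2 E"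
    if "E \<in> sets (?F T)" "E \<subseteq> (space M - A1) \<union> (space M - A2)" for E
    unfolding R2_def
  proof (rule tilt2(1)[OF T0 that(1)])
    show "0 \<le> ?X2 T \<omega>" if "\<omega> \<in> E" for \<omega>
      using A_nonneg[of \<omega>] at_T[of \<omega>] that \<open>E \<subseteq> _\<close> by auto
  qed
  \<comment> \<open>The paths meet at \<open>T\<close>, so immediate ruin of one company starts from the zero level of the other.\<close>
  have D1: "measure M D1 = ?\<psi>2 * measure Q2 D1"
    using I1.ruin_at_once_afterD(1)[OF _ T0, folded D1_def] at_T
      I1.ruin_at_once_after_null[OF levy _ _ _ drift1 T0, folded D1_def]
    by (intro tilt2(2)[OF T0 sets_D(1)]) auto
  have D2: "measure M D2 = ?\<psi>1 * measure Q1 D2"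
    using I2.ruin_at_once_afterD(1)[OF _ T0, folded D2_def] at_T
      I2.ruin_at_once_after_null[OF levy _ _ _ drift2 T0, folded D2_def]
    by (intro tilt1(2)[OF T0 sets_D(2)]) auto
  have Q1_by: "ruin_prob_by Q1 S p2 x2 T = measure Q1 A2 + measure Q1 D2"
  proof -
    have "A2 \<inter> D2 = {}" by (auto simp: A2_def D2_def I2.ruin_at_once_after_def)
    then show ?thesis
      unfolding ruin_prob_by_def I1.space_Q I2.ruin_time_le_eq[of T, folded A2_def D2_def]
      using sets_A(2) sets_D(2)[of 1]
      by (intro I1.Q.finite_measure_Union I1.F_subset_Q) auto
  qed
  have Q2_by: "ruin_prob_by Q2 S p1 x1 T = measure Q2 A1 + measure Q2 D1"
  proof -
    have "A1 \<inter> D1 = {}" by (auto simp: A1_def D1_def I1.ruin_at_once_after_def)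
    then show ?thesis
      unfolding ruin_prob_by_def I2.space_Q I1.ruin_time_le_eq[of T, folded A1_def D1_def]
      using sets_A(1) sets_D(1)[of 1]
      by (intro I2.Q.finite_measure_Union I2.F_subset_Q) auto
  qed
  have union: "measure M (E \<union> ((space M - E) \<inter> R)) = measure M E + measure M ((space M - E) \<inter> R)"
    if "E \<in> sets M" "R \<in> sets M" for E R
    using that by (intro I1.finite_measure_Union) auto

  have "ruin_sim M S p1 p2 x1 x2 = measure M (A2 \<union> ((space M - A2) \<inter> R1))"
    unfolding ruin_sim_def
  proof (intro arg_cong[where f = "measure M"] equalityI subsetI)
    fix \<omega> assume "\<omega> \<in> {\<omega> \<in> space M. \<exists>t\<ge>0. ?X1 t \<omega> < 0 \<and> ?X2 t \<omega> < 0}"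
    then obtain t where "\<omega> \<in> space M" "0 \<le> t" "?X1 t \<omega> < 0" "?X2 t \<omega> < 0" by blast
    then show "\<omega> \<in> A2 \<union> ((space M - A2) \<inter> R1)"
      unfolding A2_def R1_def I2.ruined_def I1.ruined_after_def by (cases "t \<le> T") auto
  next
    fix \<omega> assume \<omega>: "\<omega> \<in> A2 \<union> ((space M - A2) \<inter> R1)"
    then consider t where "0 \<le> t" "t \<le> T" "?X2 t \<omega> < 0" | t where "T \<le> t" "?X1 t \<omega> < 0"
      unfolding A2_def R1_def I2.ruined_def I1.ruined_after_def by auto
    then have "\<exists>t\<ge>0. ?X1 t \<omega> < 0 \<and> ?X2 t \<omega> < 0"
      by cases (meson before after le_less_trans order_trans T0)+
    moreover have "\<omega> \<in> space M" using \<omega> by (auto simp: A2_def I2.ruined_def)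
    ultimately show "\<omega> \<in> {\<omega> \<in> space M. \<exists>t\<ge>0. ?X1 t \<omega> < 0 \<and> ?X2 t \<omega> < 0}" by blast
  qed
  also have "\<dots> = measure M A2 + ?\<psi>1 * (1 - measure Q1 A2)"
    unfolding union[OF M_A(2) M_R(1)] later1
    using I1.Q.prob_compl[OF I1.F_subset_Q[OF sets_A(2)]] by simp
  also have "\<dots> = ruin_prob_by M S p2 x2 T + ?\<psi>1 * survival_prob_until Q1 S p2 x2 T"
    unfolding survival_prob_until_def Q1_by I2.ruin_prob_by_eq(1)[OF T0, folded A2_def D2_def] D2
    by (simp add: algebra_simps)
  finally have sim: "ruin_sim M S p1 p2 x1 x2 =
      ruin_prob_by M S p2 x2 T + ?\<psi>1 * survival_prob_until Q1 S p2 x2 T" .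

  have "ruin_or M S p1 p2 x1 x2 = measure M (A1 \<union> ((space M - A1) \<inter> R2))"
    unfolding ruin_or_def
  proof (intro arg_cong[where f = "measure M"] equalityI subsetI)
    fix \<omega> assume "\<omega> \<in> {\<omega> \<in> space M. \<exists>t\<ge>0. ?X1 t \<omega> < 0 \<or> ?X2 t \<omega> < 0}"
    then obtain t where t: "\<omega> \<in> space M" "0 \<le> t" "?X1 t \<omega> < 0 \<or> ?X2 t \<omega> < 0" by blast
    show "\<omega> \<in> A1 \<union> ((space M - A1) \<inter> R2)"
    proof (cases "t \<le> T")
      case True
      then have "?X1 t \<omega> < 0" using t before[OF True, of \<omega>] by auto
      then show ?thesis using True t unfolding A1_def I1.ruined_def by auto
    next
      case False
      then have "?X2 t \<omega> < 0" using t after[of t \<omega>] by auto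
      then show ?thesis using False t unfolding R2_def I2.ruined_after_def by (auto intro!: exI[of _ t])
    qed
  next
    fix \<omega> assume "\<omega> \<in> A1 \<union> ((space M - A1) \<inter> R2)"
    then show "\<omega> \<in> {\<omega> \<in> space M. \<exists>t\<ge>0. ?X1 t \<omega> < 0 \<or> ?X2 t \<omega> < 0}"
      unfolding A1_def R2_def I1.ruined_def I2.ruined_after_def using T0
      by (auto intro: order_trans)
  qed
  also have "\<dots> = measure M A1 + ?\<psi>2 * (1 - measure Q2 A1)"
    unfolding union[OF M_A(1) M_R(2)]
    using later2[OF compl[OF sets_A(1)]] I2.Q.prob_compl[OF I2.F_subset_Q[OF sets_A(1)]] by simp
  also have "\<dots> = ruin_prob_by M S p1 x1 T + ?\<psi>2 * survival_prob_until Q2 S p1 x1 T"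
    unfolding survival_prob_until_def Q2_by I1.ruin_prob_by_eq(1)[OF T0, folded A1_def D1_def] D1
    by (simp add: algebra_simps)
  finally have or: "ruin_or M S p1 p2 x1 x2 =
      ruin_prob_by M S p1 x1 T + ?\<psi>2 * survival_prob_until Q2 S p1 x1 T" .

  \<comment> \<open>Ruin of the second company splits into ruin up to \<open>T\<close> and ruin after survival up to \<open>T\<close>; the second
    part is known, so the first follows by subtraction.\<close>
  have A2: "measure M A2 = ?\<psi>2 * measure Q2 A2"
  proof -
    have "I2.ruined_after 0 = A2 \<union> ((space M - A2) \<inter> R2)"
      unfolding A2_def R2_def I2.ruined_def I2.ruined_after_def using T0
      by (auto simp: not_less intro: order_trans) (meson atLeastAtMost_iff linear not_le)
    then have "?\<psi>2 = measure M A2 + ?\<psi>2 * measure Q2 (space M - A2)"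
      using union[OF M_A(2) M_R(2)] later2[OF compl[OF sets_A(2)]] by (simp add: I2.ruin_prob_eq)
    moreover have "measure Q2 (space M - A2) = 1 - measure Q2 A2"
      using I2.Q.prob_compl[OF I2.F_subset_Q[OF sets_A(2)]] by simp
    ultimately show ?thesis by (simp add: right_diff_distrib)
  qed
  \<comment> \<open>Three disjoint cases: the first path is negative only from \<open>T\<close> on, and then so is the second, being
    lower; the second is negative up to \<open>T\<close>, and then so is the first; the first is negative up to \<open>T\<close> and
    the second only afterwards.\<close>
  have "ruin_and M S p1 p2 x1 x2 =
      measure M (((space M - A1) \<inter> R1) \<union> (A2 \<union> ((A1 - A2) \<inter> R2)))"
    unfolding ruin_and_def I1.ruin_time_finite_iff I2.ruin_time_finite_iff
  proof (intro arg_cong[where f = "measure M"] equalityI subsetI)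
    fix \<omega> assume "\<omega> \<in> {\<omega> \<in> space M. (\<exists>t\<ge>0. ?X1 t \<omega> < 0) \<and> (\<exists>t\<ge>0. ?X2 t \<omega> < 0)}"
    then obtain t u where tu: "\<omega> \<in> space M" "0 \<le> t" "?X1 t \<omega> < 0" "0 \<le> u" "?X2 u \<omega> < 0" by blast
    then have "\<omega> \<in> A1 \<or> \<omega> \<in> R1"
      unfolding A1_def R1_def I1.ruined_def I1.ruined_after_def by (cases "t \<le> T") auto
    moreover have "\<omega> \<in> A2 \<or> \<omega> \<in> R2"
      using tu unfolding A2_def R2_def I2.ruined_def I2.ruined_after_def by (cases "u \<le> T") auto
    ultimately show "\<omega> \<in> ((space M - A1) \<inter> R1) \<union> (A2 \<union> ((A1 - A2) \<inter> R2))"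
      using tu(1) by blast
  next
    fix \<omega> assume \<omega>: "\<omega> \<in> ((space M - A1) \<inter> R1) \<union> (A2 \<union> ((A1 - A2) \<inter> R2))"
    have "\<omega> \<in> R1 \<Longrightarrow> \<omega> \<in> R2"
      unfolding R1_def R2_def I1.ruined_after_def I2.ruined_after_def
      using after by (auto intro: le_less_trans)
    then have "(\<omega> \<in> A1 \<or> \<omega> \<in> R1) \<and> (\<omega> \<in> A2 \<or> \<omega> \<in> R2)" using \<omega> A2_A1 by blast
    then show "\<omega> \<in> {\<omega> \<in> space M. (\<exists>t\<ge>0. ?X1 t \<omega> < 0) \<and> (\<exists>t\<ge>0. ?X2 t \<omega> < 0)}"
      unfolding A1_def A2_def R1_def R2_def I1.ruined_def I2.ruined_def I1.ruined_after_def I2.ruined_after_def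
      using T0 by (auto intro: order_trans)
  qed
  also have "\<dots> = measure M ((space M - A1) \<inter> R1) + (measure M A2 + measure M ((A1 - A2) \<inter> R2))"
    using A2_A1 by (subst I1.finite_measure_Union, measurable, blast,
      subst I1.finite_measure_Union, measurable, blast, simp)
  also have "measure M ((A1 - A2) \<inter> R2) = ?\<psi>2 * measure Q2 (A1 - A2)"
    using sets_A sets.sets_into_space[OF sets_A(1)] by (intro later2) auto
  also have "measure Q2 (A1 - A2) = measure Q2 A1 - measure Q2 A2"
    using sets_A[THEN I2.F_subset_Q] A2_A1 by (intro I2.Q.finite_measure_Diff) auto
  also have "measure M ((space M - A1) \<inter> R1) = late_ruin_prob M S p1 x1 T + measure M D1"
    using I1.late_ruin_prob_eq[OF T0] by (simp add: A1_def R1_def D1_def)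
  finally have "ruin_and M S p1 p2 x1 x2 =
      late_ruin_prob M S p1 x1 T + ?\<psi>2 * ruin_prob_by Q2 S p1 x1 T"
    unfolding A2 D1 Q2_by by (simp add: algebra_simps)
  with sim or show ?thesis by blast
qed

end
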